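(* Almost all cographs have a generalized cospectral mate in the family of cographs. That is, if $c_n$ denotes the number of isomorphism classes of cographs on $n$ vertices and $h_n$ the number of those isomorphism classes of cographs $G$ on $n$ vertices for which there exists a cograph $H$ with $H\not\cong G$, $\mathrm{Spec}(H)=\mathrm{Spec}(G)$ and $\mathrm{Spec}(\overline{H})=\mathrm{Spec}(\overline{G})$, then $h_n/c_n\to 1$ as $n\to\infty$.
   Context: A cograph is a finite simple graph obtained from the single-vertex graph by repeatedly applying disjoint union of two cographs and complementation (equivalently, a graph with no induced path on 4 vertices). $\overline{G}$ denotes the complement of $G$. For a graph $G$ with adjacency matrix $A$, $\mathrm{Spec}(G)$ is the multiset of eigenvalues of $A$. Two graphs are generalized cospectral if they have the same spectrum and their complements have the same spectrum. *)

theory Defs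
  imports Complex_Main "HOL-Library.Multiset" "HOL-Computational_Algebra.Polynomial"
    "Jordan_Normal_Form.Char_Poly"
begin

definition graph_compl :: "nat set \<Rightarrow> (nat \<Rightarrow> nat \<Rightarrow> bool) \<Rightarrow> (nat \<Rightarrow> nat \<Rightarrow> bool)" where
  "graph_compl V E = (\<lambda>x y. x \<in> V \<and> y \<in> V \<and> x \<noteq> y \<and> \<not> E x y)"

inductive cograph :: "nat set \<Rightarrow> (nat \<Rightarrow> nat \<Rightarrow> bool) \<Rightarrow> bool" where
  single: "cograph {v} (\<lambda>x y. False)"
| union: "cograph V1 E1 \<Longrightarrow> cograph V2 E2 \<Longrightarrow> V1 \<inter> V2 = {} \<Longrightarrow>
          cograph (V1 \<union> V2) (\<lambda>x y. E1 x y \<or> E2 x y)"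
| compl: "cograph V E \<Longrightarrow> cograph V (graph_compl V E)"

definition cographs_on :: "nat \<Rightarrow> (nat \<Rightarrow> nat \<Rightarrow> bool) set" where
  "cographs_on n = {E. cograph {0..<n} E}"

definition graph_iso :: "nat \<Rightarrow> (nat \<Rightarrow> nat \<Rightarrow> bool) \<Rightarrow> (nat \<Rightarrow> nat \<Rightarrow> bool) \<Rightarrow> bool" where
  "graph_iso n E F = (\<exists>f. bij_betw f {0..<n} {0..<n} \<and>
      (\<forall>x\<in>{0..<n}. \<forall>y\<in>{0..<n}. E x y \<longleftrightarrow> F (f x) (f y)))"

definition iso_rel :: "nat \<Rightarrow> ((nat \<Rightarrow> nat \<Rightarrow> bool) \<times> (nat \<Rightarrow> nat \<Rightarrow> bool)) set" where
  "iso_rel n = {(E, F). graph_iso n E F}"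

definition adj_mat :: "nat \<Rightarrow> (nat \<Rightarrow> nat \<Rightarrow> bool) \<Rightarrow> real mat" where
  "adj_mat n E = mat n n (\<lambda>(i, j). if E i j then 1 else 0)"

definition Spec :: "nat \<Rightarrow> (nat \<Rightarrow> nat \<Rightarrow> bool) \<Rightarrow> complex multiset" where
  "Spec n E = proots (char_poly (map_mat complex_of_real (adj_mat n E)))"

definition cograph_classes :: "nat \<Rightarrow> (nat \<Rightarrow> nat \<Rightarrow> bool) set set" where
  "cograph_classes n = cographs_on n // iso_rel n"

definition has_gc_cograph_mate :: "nat \<Rightarrow> (nat \<Rightarrow> nat \<Rightarrow> bool) \<Rightarrow> bool" where
  "has_gc_cograph_mate n G = (\<exists>H \<in> cographs_on n. \<not> graph_iso n H G \<and>
      Spec n H = Spec n G \<and>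
      Spec n (graph_compl {0..<n} H) = Spec n (graph_compl {0..<n} G))"

definition c_count :: "nat \<Rightarrow> nat" where
  "c_count n = card (cograph_classes n)"

definition h_count :: "nat \<Rightarrow> nat" where
  "h_count n = card {C \<in> cograph_classes n. \<exists>G\<in>C. has_gc_cograph_mate n G}"

end

theory Submission
  imports Defs "HOL-Analysis.Harmonic_Numbers"
begin

text \<open>A cograph is determined by its cotree and the type of the root, and two small cographs with the same
  spectrum and the same complementary spectrum are conjugate by an orthogonal matrix fixing the
  all-ones vector. Extending that matrix by the identity shows that replacing one of them by the
  other, as a limb of a cotree, changes neither spectrum; it always changes the cotree, hence the isomorphism class.
  It remains to see that almost all cotrees contain a given limb. If \<open>A\<close> is the generating function of cotrees,
  then \<open>1 + 2 A(y) - y = exp (A(y) + R(y))\<close>, where \<open>R\<close> only involves \<open>A(y\<^sup>2), A(y\<^sup>3), \<dots>\<close>. Convexity of \<open>exp\<close> gives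
  \<open>2 R(y) + y \<le> 2 ln 2 - 1\<close> up to the radius of convergence \<open>\<rho>\<close>. For cotrees avoiding a limb with \<open>m\<close> leaves the
  left-hand side gains a term \<open>y\<^sup>m\<close>, and the strict inequality \<open>2 R(y) + y < 2 ln 2 - 1 + y\<^sup>m\<close>, which persists
  slightly beyond \<open>\<rho>\<close>, prevents the partial sums of the generating function from ever crossing a fixed barrier.
  So its radius of convergence exceeds \<open>\<rho>\<close>, while the number of all cotrees is bounded below by a constant times \<open>y\<^sup>-\<^sup>n\<close>
  for every \<open>y > \<rho>\<close> close to \<open>\<rho>\<close>, by supermultiplicativity.\<close>

section \<open>Cotrees and their generating functions\<close>

datatype tree = Leaf | Node "tree multiset"

primrec leaves :: "tree \<Rightarrow> nat" where
  "leaves Leaf = 1"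
| "leaves (Node M) = sum_mset (image_mset leaves M)"

text \<open>Inner vertices with at least two children make \<open>adm {}\<close> the class of
  cotrees. Join and union alternate from level to level, so the tree carries no labels and the root
  type alone is recorded elsewhere. \<open>X\<close> holds the forbidden limbs.\<close>

inductive adm :: "tree set \<Rightarrow> tree \<Rightarrow> bool" for X where
  Leaf: "adm X Leaf"
| Node: "size M \<ge> 2 \<Longrightarrow> (\<And>t. t \<in># M \<Longrightarrow> adm X t) \<Longrightarrow> Node M \<notin> X \<Longrightarrow> adm X (Node M)"

lemma adm_Node_iff: "adm X (Node M) \<longleftrightarrow> size M \<ge> 2 \<and> (\<forall>t\<in>#M. adm X t) \<and> Node M \<notin> X"
  by (auto elim: adm.cases intro: adm.Node)

lemma adm_mono: "adm X t \<Longrightarrow> Y \<subseteq> X \<Longrightarrow> adm Y t"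
  by (induction rule: adm.induct) (auto intro: adm.intros)

lemma leaves_pos: "adm X t \<Longrightarrow> leaves t \<ge> 1"
proof (induction rule: adm.induct)
  case (Node M)
  then obtain t where t: "t \<in># M" by (metis not_numeral_le_zero multiset_nonemptyE size_empty)
  then obtain M' where "M = add_mset t M'" by (metis mset_add)
  with Node.IH[OF t] show ?case by simp
qed auto

lemma leaves_le_sum: "t \<in># M \<Longrightarrow> leaves t \<le> leaves (Node M)"
  by (metis image_mset_add_mset leaves.simps(2) le_add1 mset_add sum_mset.add_mset)

lemma size_le_leaves:
  assumes "\<And>t. t \<in># M \<Longrightarrow> leaves t \<ge> 1" shows "size M \<le> leaves (Node M)"
  using assms
proof (induction M)
  case (add t M)
  have "leaves t \<ge> 1" "size M \<le> leaves (Node M)" using add by auto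
  then show ?case by simp
qed simp

text \<open>At least one sibling exists and contributes a leaf. The children of a root are thus
  confined to strictly smaller trees.\<close>

lemma leaves_child_less:
  assumes "adm X (Node M)" "t \<in># M"
  shows "leaves t < leaves (Node M)"
proof -
  obtain M' where M: "M = add_mset t M'" using assms(2) by (metis mset_add)
  have "size M' \<ge> 1" and *: "\<And>s. s \<in># M' \<Longrightarrow> leaves s \<ge> 1"
    using assms leaves_pos[of X] by (auto simp: M adm_Node_iff)
  then have "leaves (Node M') \<ge> 1"
    using size_le_leaves[of M'] * by (meson order_trans)
  then show ?thesis by (simp add: M)
qed

definition trees :: "tree set \<Rightarrow> nat \<Rightarrow> tree set" where
  "trees X N = {t. adm X t \<and> leaves t \<le> N}"

lemma finite_bounded_multisets:
  assumes "finite S" shows "finite {M. set_mset M \<subseteq> S \<and> size M \<le> (N::nat)}"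
proof -
  have "{M. set_mset M \<subseteq> S \<and> size M \<le> N} \<subseteq> mset ` {xs. set xs \<subseteq> S \<and> length xs \<le> N}"
  proof
    fix M assume "M \<in> {M. set_mset M \<subseteq> S \<and> size M \<le> N}"
    moreover obtain xs where "M = mset xs" by (metis ex_mset)
    ultimately show "M \<in> mset ` {xs. set xs \<subseteq> S \<and> length xs \<le> N}" by auto
  qed
  then show ?thesis
    using finite_lists_length_le[OF assms] finite_subset by blast
qed

text \<open>Induction on \<open>N\<close>: the children of a root have fewer leaves than the whole
  tree, and there are at most as many children as leaves.\<close>

lemma finite_trees: "finite (trees X N)"
proof (induction N)
  case 0
  have "trees X 0 = {}" using leaves_pos by (fastforce simp: trees_def)
  then show ?case by simp
next
  case (Suc N)
  have "trees X (Suc N) \<subseteq> {Leaf} \<union> Node ` {M. set_mset M \<subseteq> trees X N \<and> size M \<le> Suc N}"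
  proof
    fix t assume t: "t \<in> trees X (Suc N)"
    show "t \<in> {Leaf} \<union> Node ` {M. set_mset M \<subseteq> trees X N \<and> size M \<le> Suc N}"
    proof (cases t)
      case (Node M)
      have a: "adm X (Node M)" "leaves (Node M) \<le> Suc N" using t Node by (auto simp: trees_def)
      have "set_mset M \<subseteq> trees X N"
      proof
        fix s assume s: "s \<in># M"
        have "leaves s < leaves (Node M)" using leaves_child_less[OF a(1) s] .
        then show "s \<in> trees X N" using a s by (auto simp: trees_def adm_Node_iff)
      qed
      moreover have "size M \<le> leaves (Node M)"
        by (rule size_le_leaves) (use a leaves_pos in \<open>auto simp: adm_Node_iff\<close>)
      ultimately show ?thesis using Node a by auto
    qed auto
  qed
  then show ?case
    by (rule finite_subset) (use finite_bounded_multisets[OF Suc, of "Suc N"] in \<open>simp del: leaves.simps\<close>)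
qed

definition tree_count :: "tree set \<Rightarrow> nat \<Rightarrow> nat" where
  "tree_count X n = card {t. adm X t \<and> leaves t = n}"

lemma finite_trees_eq: "finite {t. adm X t \<and> leaves t = n}"
  by (rule finite_subset[OF _ finite_trees[of X n]]) (auto simp: trees_def)

lemma sum_trees: "(\<Sum>t\<in>trees X N. (y::real) ^ leaves t) = (\<Sum>n\<le>N. real (tree_count X n) * y ^ n)"
proof -
  have "(\<Sum>t\<in>trees X N. y ^ leaves t) = (\<Sum>n\<le>N. \<Sum>t\<in>{t\<in>trees X N. leaves t = n}. y ^ leaves t)"
    by (rule sum.group[symmetric]) (use finite_trees[of X N] in \<open>auto simp: trees_def\<close>)
  also have "\<dots> = (\<Sum>n\<le>N. \<Sum>t\<in>{t. adm X t \<and> leaves t = n}. y ^ n)"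
    by (intro sum.cong) (auto simp: trees_def)
  finally show ?thesis by (simp add: tree_count_def)
qed

lemma sum_trees_le_suminf:
  assumes "finite U" "\<And>t. t \<in> U \<Longrightarrow> adm X t" "summable (\<lambda>n. real (tree_count X n) * y ^ n)" "0 \<le> y"
  shows "(\<Sum>t\<in>U. y ^ leaves t) \<le> (\<Sum>n. real (tree_count X n) * y ^ n)"
proof -
  define N where "N = Max (insert 0 (leaves ` U))"
  have "U \<subseteq> trees X N" using assms(1,2) by (auto simp: trees_def N_def)
  then have "(\<Sum>t\<in>U. y ^ leaves t) \<le> (\<Sum>t\<in>trees X N. y ^ leaves t)"
    by (intro sum_mono2 finite_trees) (use assms in auto)
  also have "\<dots> \<le> (\<Sum>n. real (tree_count X n) * y ^ n)"
    unfolding sum_trees by (rule sum_le_suminf) (use assms in auto)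
  finally show ?thesis .
qed

section \<open>Products over trees as sums over multisets of trees\<close>

definition bounded_msets :: "'a set \<Rightarrow> nat \<Rightarrow> 'a multiset set" where
  "bounded_msets S K = {M. set_mset M \<subseteq> S \<and> (\<forall>s. count M s \<le> K)}"

lemma bij_bounded_msets:
  assumes "finite S"
  shows "bij_betw (\<lambda>M. restrict (count M) S) (bounded_msets S K) (S \<rightarrow>\<^sub>E {..K})"
proof (rule bij_betwI')
  fix M M' assume "M \<in> bounded_msets S K" "M' \<in> bounded_msets S K"
  then have z: "count M s = 0" "count M' s = 0" if "s \<notin> S" for s
    using that by (auto simp: bounded_msets_def count_eq_zero_iff)
  show "(restrict (count M) S = restrict (count M') S) \<longleftrightarrow> M = M'"
  proof
    assume h: "restrict (count M) S = restrict (count M') S"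
    show "M = M'"
    proof (rule multiset_eqI)
      fix s show "count M s = count M' s"
        using fun_cong[OF h, of s] z[of s] by (cases "s \<in> S") auto
    qed
  qed simp
next
  fix M assume "M \<in> bounded_msets S K"
  then show "restrict (count M) S \<in> S \<rightarrow>\<^sub>E {..K}" by (auto simp: bounded_msets_def)
next
  fix g assume g: "g \<in> S \<rightarrow>\<^sub>E {..K}"
  define M where "M = Abs_multiset (\<lambda>s. if s \<in> S then g s else 0)"
  have "finite {s. 0 < (if s \<in> S then g s else 0)}"
    by (rule finite_subset[OF _ assms]) (auto split: if_splits)
  then have c: "count M s = (if s \<in> S then g s else 0)" for s
    by (simp add: M_def)
  have "M \<in> bounded_msets S K"
    using g c by (auto simp: bounded_msets_def PiE_def Pi_def count_greater_zero_iff[symmetric]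
        simp del: count_greater_zero_iff split: if_splits)
  moreover have "g = restrict (count M) S"
    using g by (auto simp: c fun_eq_iff PiE_def extensional_def)
  ultimately show "\<exists>M\<in>bounded_msets S K. g = restrict (count M) S" by blast
qed

lemma finite_bounded_msets: "finite S \<Longrightarrow> finite (bounded_msets S K)"
  using bij_betw_finite[OF bij_bounded_msets] finite_PiE[of S "\<lambda>_. {..K}"] by blast

lemma power_leaves_Node:
  assumes "finite S" "set_mset M \<subseteq> S"
  shows "(y::real) ^ leaves (Node M) = (\<Prod>s\<in>S. (y ^ leaves s) ^ count M s)"
  using assms(2)
proof (induction M)
  case (add t M)
  have "(\<Prod>s\<in>S. (y ^ leaves s) ^ count (add_mset t M) s) =
        (\<Prod>s\<in>S. (if s = t then y ^ leaves s else 1) * (y ^ leaves s) ^ count M s)"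
    by (intro prod.cong) auto
  also have "\<dots> = y ^ leaves t * (\<Prod>s\<in>S. (y ^ leaves s) ^ count M s)"
    using add.prems assms(1) by (simp add: prod.distrib prod.delta)
  finally show ?case using add by (simp add: power_add)
qed simp

text \<open>Bounded multiplicities turn the multisets into a finite box of exponent functions, so
  the sum factors tree by tree into truncated geometric series.\<close>

lemma sum_bounded_msets:
  assumes "finite S"
  shows "(\<Sum>M\<in>bounded_msets S K. (y::real) ^ leaves (Node M)) = (\<Prod>s\<in>S. \<Sum>k\<le>K. (y ^ leaves s) ^ k)"
proof -
  have "(\<Sum>M\<in>bounded_msets S K. y ^ leaves (Node M)) =
        (\<Sum>M\<in>bounded_msets S K. \<Prod>s\<in>S. (y ^ leaves s) ^ (restrict (count M) S s))"
    by (intro sum.cong refl, subst power_leaves_Node[OF assms]) (auto simp: bounded_msets_def)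
  also have "\<dots> = (\<Sum>g\<in>S \<rightarrow>\<^sub>E {..K}. \<Prod>s\<in>S. (y ^ leaves s) ^ g s)"
    by (rule sum.reindex_bij_betw[OF bij_bounded_msets[OF assms]])
  also have "\<dots> = (\<Prod>s\<in>S. \<Sum>k\<le>K. (y ^ leaves s) ^ k)"
    by (rule prod_sum_PiE[symmetric]) (use assms in auto)
  finally show ?thesis .
qed

lemma power_leaves_less_1:
  assumes "adm X t" "0 \<le> y" "y < (1::real)" shows "y ^ leaves t < 1"
  using leaves_pos[OF assms(1)] assms(2,3) by (simp add: power_less_one_iff)

text \<open>Expanding the geometric series gives a sum over multisets of trees. The empty multiset
  yields 1, the singletons yield the sum over \<open>trees X N\<close>, and the child multisets of
  its inner trees yield that sum again without the leaf's \<open>y\<close>. \<open>D\<close> adds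
  multisets that these three kinds miss, such as the children of a forbidden limb.\<close>

lemma product_lower_bound:
  assumes y: "0 \<le> y" "y < (1::real)" and N: "N \<ge> 1" and D: "finite D"
    "\<And>M. M \<in> D \<Longrightarrow> size M \<ge> 2 \<and> set_mset M \<subseteq> trees X N \<and> Node M \<notin> trees X N"
  shows "1 + 2 * (\<Sum>t\<in>trees X N. y ^ leaves t) - y + (\<Sum>M\<in>D. y ^ leaves (Node M))
         \<le> (\<Prod>t\<in>trees X N. 1 / (1 - y ^ leaves t))"
proof -
  let ?S = "trees X N" and ?f = "\<lambda>M. y ^ leaves (Node M)"
  define P where "P = {M. Node M \<in> ?S}"
  have fS: "finite ?S" by (rule finite_trees)
  have "P = Node -` ?S" by (auto simp: P_def)
  then have fP: "finite P" using fS by (simp add: finite_vimageI inj_def)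
  have S_eq: "?S = insert Leaf (Node ` P)"
  proof -
    have "Leaf \<in> ?S" using N by (simp add: trees_def adm.Leaf)
    moreover have "t = Leaf \<or> t \<in> Node ` P" if "t \<in> ?S" for t
      using that by (cases t) (auto simp: P_def)
    ultimately show ?thesis by (auto simp: P_def)
  qed
  have sum_S: "(\<Sum>t\<in>?S. y ^ leaves t) = y + (\<Sum>M\<in>P. ?f M)"
  proof -
    have "(\<Sum>t\<in>?S. y ^ leaves t) = y + (\<Sum>t\<in>Node ` P. y ^ leaves t)"
      by (subst S_eq, subst sum.insert) (use fP in auto)
    also have "(\<Sum>t\<in>Node ` P. y ^ leaves t) = (\<Sum>M\<in>P. ?f M)"
      by (subst sum.reindex) (auto simp: inj_on_def)
    finally show ?thesis .
  qed
  have P2: "size M \<ge> 2 \<and> set_mset M \<subseteq> ?S" if "M \<in> P" for M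
  proof -
    have "adm X (Node M)" "leaves (Node M) \<le> N" using that by (auto simp: P_def trees_def)
    moreover have "leaves t \<le> N" if "t \<in># M" for t
      using leaves_le_sum[OF that] \<open>leaves (Node M) \<le> N\<close> by linarith
    ultimately show ?thesis by (auto simp: adm_Node_iff trees_def)
  qed
  define sg where "sg = (\<lambda>t::tree. {#t#}) ` ?S"
  define W where "W = {{#}} \<union> sg \<union> P \<union> D"
  have fW: "finite W" using fS fP D by (auto simp: W_def sg_def)
  \<comment> \<open>Truncating every geometric series at the largest size in \<open>W\<close> loses
    no member of \<open>W\<close>.\<close>
  define K where "K = Max (size ` W)"
  have "W \<subseteq> bounded_msets ?S K"
  proof
    fix M assume M: "M \<in> W"
    have "size M \<le> K" using M fW by (auto simp: K_def)
    then have "count M s \<le> K" for s using count_le_size[of M s] by linarith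
    moreover have "set_mset M \<subseteq> ?S" using M P2 D(2) by (auto simp: W_def sg_def)
    ultimately show "M \<in> bounded_msets ?S K" by (auto simp: bounded_msets_def)
  qed
  then have le: "(\<Sum>M\<in>W. ?f M) \<le> (\<Sum>M\<in>bounded_msets ?S K. ?f M)"
    by (intro sum_mono2 finite_bounded_msets fS) (use y in auto)
  have "(\<Sum>M\<in>W. ?f M) = (\<Sum>M\<in>{{#}}. ?f M) + (\<Sum>M\<in>sg. ?f M) + (\<Sum>M\<in>P. ?f M) + (\<Sum>M\<in>D. ?f M)"
  proof -
    \<comment> \<open>\<open>Node\<close> sends members of \<open>P\<close> into the range of trees
      and members of \<open>D\<close> outside it; sizes separate both from the empty multiset and
      the singletons.\<close>
    have d1: "({{#}} \<union> sg \<union> P) \<inter> D = {}"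
      using D(2) by (auto simp: sg_def P_def) force+
    have d2: "({{#}} \<union> sg) \<inter> P = {}"
      using P2 by (auto simp: sg_def) force+
    have d3: "{{#}} \<inter> sg = {}" by (auto simp: sg_def)
    have f: "finite sg" using fS by (simp add: sg_def)
    show ?thesis unfolding W_def
      using d1 d2 d3 f fP D(1) by (simp add: sum.union_disjoint del: Un_insert_left insert_disjoint)
  qed
  also have "(\<Sum>M\<in>sg. ?f M) = (\<Sum>t\<in>?S. y ^ leaves t)"
    unfolding sg_def by (subst sum.reindex) (auto simp: inj_on_def)
  also have "(\<Sum>M\<in>{{#}}. ?f M) + (\<Sum>t\<in>?S. y ^ leaves t) + (\<Sum>M\<in>P. ?f M) + (\<Sum>M\<in>D. ?f M) =
    1 + 2 * (\<Sum>t\<in>?S. y ^ leaves t) - y + (\<Sum>M\<in>D. ?f M)"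
    using sum_S by simp
  finally have "1 + 2 * (\<Sum>t\<in>?S. y ^ leaves t) - y + (\<Sum>M\<in>D. ?f M) \<le> (\<Sum>M\<in>bounded_msets ?S K. ?f M)"
    using le by simp
  also have "(\<Sum>M\<in>bounded_msets ?S K. ?f M) \<le> (\<Prod>t\<in>?S. 1 / (1 - y ^ leaves t))"
    unfolding sum_bounded_msets[OF fS]
  proof (rule prod_mono, safe)
    fix t assume "t \<in> ?S"
    then have w: "0 \<le> y ^ leaves t" "y ^ leaves t < 1"
      using y power_leaves_less_1[of X t y] by (auto simp: trees_def)
    then have "(\<Sum>k\<le>K. (y ^ leaves t) ^ k) \<le> (\<Sum>k. (y ^ leaves t) ^ k)"
      by (intro sum_le_suminf summable_geometric) auto
    then show "(\<Sum>k\<le>K. (y ^ leaves t) ^ k) \<le> 1 / (1 - y ^ leaves t)"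
      using w by (simp add: suminf_geometric)
    show "0 \<le> (\<Sum>k\<le>K. (y ^ leaves t) ^ k)" using w by (intro sum_nonneg) auto
  qed
  finally show ?thesis .
qed

text \<open>Nothing is forbidden here, so each multiset with at least two members is the child
  multiset of a cotree. Hence every truncated product is at most 1 + A + (A - y), and the truncation
  \<open>K\<close> then tends to infinity.\<close>

lemma product_upper_bound:
  assumes y: "0 \<le> y" "y < (1::real)" and S: "finite S" "\<And>t. t \<in> S \<Longrightarrow> adm {} t"
    and sm: "summable (\<lambda>n. real (tree_count {} n) * y ^ n)"
  shows "(\<Prod>t\<in>S. 1 / (1 - y ^ leaves t)) \<le> 1 + 2 * (\<Sum>n. real (tree_count {} n) * y ^ n) - y"
proof -
  let ?f = "\<lambda>M. y ^ leaves (Node M)" and ?A = "\<Sum>n. real (tree_count {} n) * y ^ n"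
  have "(\<Prod>t\<in>S. \<Sum>k\<le>K. (y ^ leaves t) ^ k) \<le> 1 + 2 * ?A - y" for K
  proof -
    define P where "P = {M \<in> bounded_msets S K. size M \<ge> 2}"
    define sg where "sg = (\<lambda>t::tree. {#t#}) ` S"
    have fB: "finite (bounded_msets S K)" by (rule finite_bounded_msets[OF S(1)])
    have "bounded_msets S K \<subseteq> {{#}} \<union> sg \<union> P"
    proof
      fix M assume M: "M \<in> bounded_msets S K"
      consider "size M = 0" | "size M = 1" | "size M \<ge> 2" by linarith
      then show "M \<in> {{#}} \<union> sg \<union> P"
      proof cases
        case 2
        then obtain t where "M = {#t#}" by (metis size_1_singleton_mset)
        then show ?thesis using M by (auto simp: sg_def bounded_msets_def)
      qed (use M in \<open>auto simp: P_def\<close>)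
    qed
    moreover have fin: "finite sg" "finite P" using fB S by (auto simp: sg_def P_def)
    ultimately have "(\<Sum>M\<in>bounded_msets S K. ?f M) \<le> (\<Sum>M\<in>{{#}} \<union> sg \<union> P. ?f M)"
      by (intro sum_mono2) (use y in auto)
    also have "\<dots> \<le> (\<Sum>M\<in>{{#}}. ?f M) + (\<Sum>M\<in>sg. ?f M) + (\<Sum>M\<in>P. ?f M)"
    proof -
      have "({{#}} \<union> sg) \<inter> P = {}" "{{#}} \<inter> sg = {}" by (auto simp: sg_def P_def)
      then show ?thesis
        using fin by (simp add: sum.union_disjoint del: Un_insert_left insert_disjoint)
    qed
    also have "(\<Sum>M\<in>sg. ?f M) = (\<Sum>t\<in>S. y ^ leaves t)"
      unfolding sg_def by (subst sum.reindex) (auto simp: inj_on_def)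
    also have "\<dots> \<le> ?A" by (rule sum_trees_le_suminf) (use S sm y in auto)
    also have "(\<Sum>M\<in>P. ?f M) \<le> ?A - y"
    proof -
      have "adm {} t" if "t \<in> insert Leaf (Node ` P)" for t
        using that by (fastforce simp: P_def bounded_msets_def adm_Node_iff intro: adm.Leaf S(2))
      then have "(\<Sum>t\<in>insert Leaf (Node ` P). y ^ leaves t) \<le> ?A"
        by (intro sum_trees_le_suminf) (use sm y fin in auto)
      moreover have "(\<Sum>t\<in>insert Leaf (Node ` P). y ^ leaves t) = y + (\<Sum>t\<in>Node ` P. y ^ leaves t)"
        by (subst sum.insert) (use fin in auto)
      moreover have "(\<Sum>t\<in>Node ` P. y ^ leaves t) = (\<Sum>M\<in>P. ?f M)"
        by (subst sum.reindex) (auto simp: inj_on_def)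
      ultimately show ?thesis by linarith
    qed
    finally show ?thesis using sum_bounded_msets[OF S(1), where y = y and K = K] by simp
  qed
  moreover have "(\<lambda>K. \<Prod>t\<in>S. \<Sum>k\<le>K. (y ^ leaves t) ^ k) \<longlonglongrightarrow> (\<Prod>t\<in>S. 1 / (1 - y ^ leaves t))"
  proof (rule tendsto_prod)
    fix t assume "t \<in> S"
    then have w: "norm (y ^ leaves t) < 1"
      using y power_leaves_less_1[of "{}" t y] S by auto
    show "(\<lambda>K. \<Sum>k\<le>K. (y ^ leaves t) ^ k) \<longlonglongrightarrow> 1 / (1 - y ^ leaves t)"
      using geometric_sums[OF w] by (simp add: sums_def_le)
  qed
  ultimately show ?thesis by (intro LIMSEQ_le_const2) auto
qed

section \<open>The radius of convergence\<close>

text \<open>On [0, 1/2] the remainder - ln (1 - w) - w grows no faster than w^2. This later compares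
  increments of \<open>log_rem\<close> with increments of a power series evaluated at
  squares.\<close>

lemma log_remainder_mono:
  assumes "0 \<le> u" "u \<le> v" "v \<le> (1/2::real)"
  shows "u\<^sup>2 + u + ln (1 - u) \<le> v\<^sup>2 + v + ln (1 - v)"
proof (rule DERIV_nonneg_imp_nondecreasing[OF assms(2), of "\<lambda>x. x\<^sup>2 + x + ln (1 - x)"])
  fix x assume x: "u \<le> x" "x \<le> v"
  have "((\<lambda>x. x\<^sup>2 + x + ln (1 - x)) has_real_derivative (2 * x + 1 - 1 / (1 - x))) (at x)"
    using x assms by (auto intro!: derivative_eq_intros simp: field_simps)
  moreover have "2 * x + 1 - 1 / (1 - x) = x * (1 - 2 * x) / (1 - x)"
    using x assms by (simp add: field_simps)
  moreover have "0 \<le> x * (1 - 2 * x) / (1 - x)" using x assms by simp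
  ultimately show "\<exists>y. ((\<lambda>x. x\<^sup>2 + x + ln (1 - x)) has_real_derivative y) (at x) \<and> 0 \<le> y"
    by metis
qed

lemma log_remainder_le: "0 \<le> w \<Longrightarrow> w \<le> 1/2 \<Longrightarrow> - ln (1 - w) - w \<le> (w::real)\<^sup>2"
  using log_remainder_mono[of 0 w] by simp

lemma log_remainder_nonneg: "w < 1 \<Longrightarrow> 0 \<le> - ln (1 - w) - (w::real)"
  using ln_le_minus_one[of "1 - w"] by simp

text \<open>Since - ln (1 - w) - w = w^2/2 + w^3/3 + ..., this is the contribution of the trees in
  \<open>S\<close> to the sum of A(y^k)/k over k \<ge> 2, the term R(y) of the functional
  equation.\<close>

definition log_rem :: "tree set \<Rightarrow> real \<Rightarrow> real" where
  "log_rem S y = (\<Sum>t\<in>S. - ln (1 - y ^ leaves t) - y ^ leaves t)"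

lemma prod_eq_exp:
  assumes "0 \<le> y" "y < 1"
  shows "(\<Prod>t\<in>trees X N. 1 / (1 - y ^ leaves t)) = exp ((\<Sum>t\<in>trees X N. y ^ leaves t) + log_rem (trees X N) y)"
proof -
  have "(\<Sum>t\<in>trees X N. y ^ leaves t) + log_rem (trees X N) y = (\<Sum>t\<in>trees X N. - ln (1 - y ^ leaves t))"
    by (simp add: log_rem_def sum.distrib[symmetric])
  moreover have "exp (\<Sum>t\<in>trees X N. - ln (1 - y ^ leaves t)) = (\<Prod>t\<in>trees X N. 1 / (1 - y ^ leaves t))"
    unfolding exp_sum[OF finite_trees]
  proof (rule prod.cong)
    fix t assume "t \<in> trees X N"
    then have "y ^ leaves t < 1" using power_leaves_less_1[of X t y] assms by (auto simp: trees_def)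
    then show "exp (- ln (1 - y ^ leaves t)) = 1 / (1 - y ^ leaves t)"
      by (simp add: exp_minus field_simps)
  qed simp
  ultimately show ?thesis by simp
qed

lemma continuous_on_sum_log:
  assumes "y1 < 1"
  shows "continuous_on {0..y1} (\<lambda>y. (\<Sum>t\<in>trees X N. y ^ leaves t) + log_rem (trees X N) y)"
proof -
  have "1 - y ^ leaves t \<noteq> 0" if "t \<in> trees X N" "y \<in> {0..y1}" for t y
    using that assms power_leaves_less_1[of X t y] by (auto simp: trees_def)
  then show ?thesis unfolding log_rem_def
    by (intro continuous_intros) auto
qed

text \<open>As \<open>y\<close> grows from 0, the logarithm of the product cannot jump over the value \<open>ln 2\<close>.\<close>

lemma sum_le_ln_2:
  assumes y1: "0 < y1" "y1 < 1"
    and no: "\<And>y. 0 < y \<Longrightarrow> y \<le> y1 \<Longrightarrow>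
      (\<Sum>t\<in>trees X N. y ^ leaves t) + log_rem (trees X N) y = ln 2 \<Longrightarrow> False"
  shows "(\<Sum>t\<in>trees X N. y1 ^ leaves t) \<le> ln 2"
proof -
  define g where "g y = (\<Sum>t\<in>trees X N. y ^ leaves t) + log_rem (trees X N) y" for y
  have l: "leaves t \<noteq> 0" if "t \<in> trees X N" for t
    using leaves_pos that by (fastforce simp: trees_def)
  have g0: "g 0 = 0"
    using l by (simp add: g_def log_rem_def zero_power)
  have "g y1 \<le> ln 2"
  proof (rule ccontr)
    assume "\<not> g y1 \<le> ln 2"
    then have "g 0 \<le> ln 2" "ln 2 \<le> g y1" using g0 by auto
    moreover have "continuous_on {0..y1} g"
      unfolding g_def by (rule continuous_on_sum_log[OF y1(2)])
    ultimately obtain y where y: "0 \<le> y" "y \<le> y1" "g y = ln 2"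
      using IVT'[of g 0 "ln 2" y1] y1 by auto
    then have "y \<noteq> 0" using g0 by auto
    then show False using no[of y] y by (simp add: g_def)
  qed
  moreover have "0 \<le> log_rem (trees X N) y1"
    unfolding log_rem_def
    by (intro sum_nonneg log_remainder_nonneg)
      (use y1 power_leaves_less_1[of X _ y1] in \<open>auto simp: trees_def\<close>)
  ultimately show ?thesis by (simp add: g_def)
qed

section \<open>Convergence at a positive point\<close>

lemma power_leaves_le:
  assumes "adm X t" "0 \<le> y" "y \<le> (1::real)" shows "y ^ leaves t \<le> y"
  using power_decreasing[of 1 "leaves t" y] leaves_pos[OF assms(1)] assms by simp

lemma log_rem_le:
  assumes "0 \<le> y" "y \<le> 1/2"
  shows "log_rem (trees X N) y \<le> y * (\<Sum>t\<in>trees X N. y ^ leaves t)"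
  unfolding log_rem_def sum_distrib_left
proof (rule sum_mono)
  fix t assume "t \<in> trees X N"
  then have le: "y ^ leaves t \<le> y" using power_leaves_le[of X t y] assms by (auto simp: trees_def)
  have "- ln (1 - y ^ leaves t) - y ^ leaves t \<le> (y ^ leaves t)\<^sup>2"
    by (rule log_remainder_le) (use le assms in auto)
  also have "\<dots> \<le> y * y ^ leaves t"
    using le assms by (simp add: power2_eq_square mult_right_mono)
  finally show "- ln (1 - y ^ leaves t) - y ^ leaves t \<le> y * y ^ leaves t" .
qed

text \<open>If the logarithm of the product equalled ln 2 at some y \<le> 1/10, then 2 b \<le> 1 + y
  would give b \<le> 11/20, and the remainder would be at most b/10. Together they reach at most
  121/200, which is below 2/3 \<le> ln 2. So the partial sums stay below ln 2.\<close>

lemma summable_tenth: "summable (\<lambda>n. real (tree_count {} n) * (1/10) ^ n)"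
proof (rule summableI_nonneg_bounded)
  fix N
  have "(\<Sum>t\<in>trees {} (Suc N). (1/10) ^ leaves t) \<le> ln (2::real)"
  proof (rule sum_le_ln_2)
    fix y :: real
    assume y: "0 < y" "y \<le> 1/10"
    let ?b = "\<Sum>t\<in>trees {} (Suc N). y ^ leaves t" and ?r = "log_rem (trees {} (Suc N)) y"
    assume eq: "?b + ?r = ln 2"
    have "1 + 2 * ?b - y \<le> exp (?b + ?r)"
      using product_lower_bound[of y "Suc N" "{}" "{}"] prod_eq_exp[of y "{}" "Suc N"] y by simp
    then have "2 * ?b \<le> 1 + y" by (simp add: eq)
    moreover have "?r \<le> y * ?b" by (rule log_rem_le) (use y in auto)
    moreover have "0 \<le> ?b" by (intro sum_nonneg) (use y in auto)
    moreover have "y * ?b \<le> (1/10) * ?b" by (intro mult_right_mono) (use y \<open>0 \<le> ?b\<close> in auto)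
    ultimately show False using eq ln2_ge_two_thirds y by linarith
  qed auto
  then have "(\<Sum>n\<le>Suc N. real (tree_count {} n) * (1/10) ^ n) \<le> ln 2"
    by (simp only: sum_trees)
  moreover have "(\<Sum>n<N. real (tree_count {} n) * (1/10) ^ n) \<le> (\<Sum>n\<le>Suc N. real (tree_count {} n) * (1/10) ^ n)"
    by (rule sum_mono2) auto
  ultimately show "(\<Sum>n<N. real (tree_count {} n) * (1/10) ^ n) \<le> ln 2" by linarith
qed simp

text \<open>The right-hand side is the tangent line of \<open>exp\<close> at \<open>ln 2\<close>; comparing it with the functional
  inequality eliminates the generating function itself and leaves only the remainder.\<close>

lemma exp_ge_tangent: "exp (t::real) \<ge> 2 + 2 * (t - ln 2)"
proof -
  have "exp t = 2 * exp (t - ln 2)" by (simp add: exp_diff)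
  moreover have "exp (t - ln 2) \<ge> 1 + (t - ln 2)" by (rule exp_ge_add_one_self)
  ultimately show ?thesis by argo
qed

section \<open>Bounds for the remainder up to the radius and slightly beyond\<close>

lemma log_rem_mono: "0 \<le> y \<Longrightarrow> y < 1 \<Longrightarrow> S \<subseteq> trees X N \<Longrightarrow> log_rem S y \<le> log_rem (trees X N) y"
  unfolding log_rem_def
  by (intro sum_mono2 finite_trees log_remainder_nonneg)
    (use power_leaves_less_1[of X _ y] in \<open>auto simp: trees_def\<close>)

lemma trees_mono: "N \<le> N' \<Longrightarrow> X' \<subseteq> X \<Longrightarrow> trees X N \<subseteq> trees X' N'"
  using adm_mono by (auto simp: trees_def)

text \<open>The tangent line leaves an error of 2 (A - b), where b is the partial sum up to
  \<open>M\<close>. Enlarging \<open>M\<close> can only increase the remainder, while the error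
  tends to 0.\<close>

lemma log_rem_bound:
  assumes y: "0 \<le> y" "y < 1" and sm: "summable (\<lambda>n. real (tree_count {} n) * y ^ n)"
  shows "2 * log_rem (trees {} N) y \<le> 2 * ln 2 - 1 - y"
proof -
  let ?A = "\<Sum>n. real (tree_count {} n) * y ^ n"
  have *: "2 * log_rem (trees {} N) y \<le> 2 * ln 2 - 1 - y + 2 * (?A - (\<Sum>n\<le>M. real (tree_count {} n) * y ^ n))"
    if "M \<ge> N" for M
  proof -
    let ?b = "\<Sum>t\<in>trees {} M. y ^ leaves t" and ?r = "log_rem (trees {} M) y"
    have "exp (?b + ?r) \<le> 1 + 2 * ?A - y"
      using product_upper_bound[OF y finite_trees _ sm, of "{}" M] prod_eq_exp[OF y, of "{}" M]
      by (simp add: trees_def)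
    then have "2 * ?r \<le> 2 * ln 2 - 1 - y + 2 * (?A - ?b)"
      using exp_ge_tangent[of "?b + ?r"] by argo
    moreover have "log_rem (trees {} N) y \<le> ?r"
      by (intro log_rem_mono y trees_mono that) auto
    ultimately show ?thesis unfolding sum_trees by linarith
  qed
  have "(\<lambda>M. 2 * ln 2 - 1 - y + 2 * (?A - (\<Sum>n\<le>M. real (tree_count {} n) * y ^ n)))
      \<longlonglongrightarrow> 2 * ln 2 - 1 - y + 2 * (?A - ?A)"
    by (intro tendsto_intros summable_LIMSEQ' sm)
  then show ?thesis
    by (intro LIMSEQ_le_const[of _ "2 * ln 2 - 1 - y"]) (use * in auto)
qed

text \<open>The radius of convergence \<rho> of the generating function of all cotrees.\<close>

definition tree_radius :: real where
  "tree_radius = Sup {y. 0 \<le> y \<and> y < 1 \<and> summable (\<lambda>n. real (tree_count {} n) * y ^ n)}"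

text \<open>As the remainder is nonnegative, y \<le> 2 ln 2 - 1, and ln 2 \<le> 25/36 turns this
  into 7/18.\<close>

lemma summable_imp_le:
  assumes "0 \<le> y" "y < 1" "summable (\<lambda>n. real (tree_count {} n) * y ^ n)"
  shows "y \<le> 7/18"
proof -
  have "0 \<le> log_rem (trees {} 0) y"
    using log_rem_mono[of y "{}" "{}" 0] assms by (simp add: log_rem_def)
  then show ?thesis using log_rem_bound[OF assms, of 0] ln2_le_25_over_36 by simp
qed

lemma bdd_above_summable: "bdd_above {y. 0 \<le> y \<and> y < 1 \<and> summable (\<lambda>n. real (tree_count {} n) * y ^ n)}"
  by (rule bdd_aboveI[of _ "7/18"]) (use summable_imp_le in blast)

lemma tree_radius_bounds: "1/10 \<le> tree_radius" "tree_radius \<le> 7/18"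
proof -
  let ?Z = "{y. 0 \<le> y \<and> y < 1 \<and> summable (\<lambda>n. real (tree_count {} n) * y ^ n)}"
  have mem: "1/10 \<in> ?Z" using summable_tenth by auto
  have ub: "\<And>y. y \<in> ?Z \<Longrightarrow> y \<le> 7/18" using summable_imp_le by auto
  show "1/10 \<le> tree_radius" unfolding tree_radius_def
    by (rule cSup_upper[OF mem bdd_above_summable])
  show "tree_radius \<le> 7/18" unfolding tree_radius_def
    by (rule cSup_least) (use mem ub in blast)+
qed

lemma summable_below_radius:
  assumes "0 \<le> y" "y < tree_radius"
  shows "summable (\<lambda>n. real (tree_count {} n) * y ^ n)"
proof -
  let ?Z = "{y. 0 \<le> y \<and> y < 1 \<and> summable (\<lambda>n. real (tree_count {} n) * y ^ n)}"
  have "1/10 \<in> ?Z" using summable_tenth by auto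
  then obtain z where "z \<in> ?Z" "y < z"
    using less_cSup_iff[OF _ bdd_above_summable, of y] assms unfolding tree_radius_def by blast
  then show ?thesis
    by (intro powser_inside[of _ z y]) (use assms in auto)
qed

lemma not_summable_above_radius:
  assumes "tree_radius < y" "y < 1"
  shows "\<not> summable (\<lambda>n. real (tree_count {} n) * y ^ n)"
proof
  assume "summable (\<lambda>n. real (tree_count {} n) * y ^ n)"
  then have "y \<le> tree_radius" unfolding tree_radius_def
    using assms tree_radius_bounds by (intro cSup_upper bdd_above_summable) auto
  then show False using assms by simp
qed

text \<open>Convergence at \<rho> itself is not established, but \<open>log_rem\<close> over
  finitely many trees is continuous, so the bound passes to the limit from the left.\<close>

lemma log_rem_bound_radius:
  assumes "0 \<le> y" "y \<le> tree_radius"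
  shows "2 * log_rem (trees {} N) y + y \<le> 2 * ln 2 - 1"
proof (cases "y < tree_radius")
  case True
  then show ?thesis
    using log_rem_bound[of y N] summable_below_radius[of y] assms tree_radius_bounds by simp
next
  case False
  then have y: "y = tree_radius" using assms by simp
  let ?f = "\<lambda>y. 2 * log_rem (trees {} N) y + y"
  have "1 - tree_radius ^ leaves t \<noteq> 0" if "t \<in> trees {} N" for t
    using that power_leaves_less_1[of "{}" t tree_radius] tree_radius_bounds by (auto simp: trees_def)
  then have "isCont ?f tree_radius"
    unfolding log_rem_def by (intro continuous_intros) auto
  then have "(?f \<longlongrightarrow> ?f tree_radius) (at_left tree_radius)"
    unfolding isCont_def by (rule tendsto_mono[OF at_le, rotated]) simp
  moreover have "eventually (\<lambda>y. y \<in> {0<..<tree_radius}) (at_left tree_radius)"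
    by (rule eventually_at_left_real) (use tree_radius_bounds in simp)
  then have "eventually (\<lambda>y. ?f y \<le> 2 * ln 2 - 1) (at_left tree_radius)"
  proof (rule eventually_mono)
    fix x assume "x \<in> {0<..<tree_radius}"
    then show "?f x \<le> 2 * ln 2 - 1"
      using log_rem_bound[of x N] summable_below_radius[of x] tree_radius_bounds by auto
  qed
  ultimately show ?thesis
    unfolding y by (intro tendsto_upperbound) auto
qed

text \<open>The remainder of w = y^leaves grows at most like w^2 = (y^2)^leaves. Summing over trees
  gives a bound independent of \<open>N\<close>.\<close>

lemma log_rem_increment:
  assumes "0 \<le> x" "x \<le> y" "y \<le> 1/2"
    and sm: "summable (\<lambda>n. real (tree_count {} n) * (x\<^sup>2) ^ n)" "summable (\<lambda>n. real (tree_count {} n) * (y\<^sup>2) ^ n)"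
  shows "log_rem (trees {} N) y - log_rem (trees {} N) x
    \<le> (\<Sum>n. real (tree_count {} n) * (y\<^sup>2) ^ n) - (\<Sum>n. real (tree_count {} n) * (x\<^sup>2) ^ n)"
proof -
  have "log_rem (trees {} N) y - log_rem (trees {} N) x \<le> (\<Sum>t\<in>trees {} N. (y\<^sup>2) ^ leaves t - (x\<^sup>2) ^ leaves t)"
    unfolding log_rem_def sum_subtractf[symmetric]
  proof (rule sum_mono)
    fix t assume t: "t \<in> trees {} N"
    have "y ^ leaves t \<le> y" using t power_leaves_le[of "{}" t y] assms by (auto simp: trees_def)
    then have "(x ^ leaves t)\<^sup>2 + x ^ leaves t + ln (1 - x ^ leaves t)
        \<le> (y ^ leaves t)\<^sup>2 + y ^ leaves t + ln (1 - y ^ leaves t)"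
      by (intro log_remainder_mono) (use assms in \<open>auto intro: power_mono\<close>)
    then show "- ln (1 - y ^ leaves t) - y ^ leaves t - (- ln (1 - x ^ leaves t) - x ^ leaves t)
        \<le> (y\<^sup>2) ^ leaves t - (x\<^sup>2) ^ leaves t"
      by (simp add: power_mult[symmetric] mult.commute)
  qed
  also have "\<dots> = (\<Sum>n\<le>N. real (tree_count {} n) * (y\<^sup>2) ^ n - real (tree_count {} n) * (x\<^sup>2) ^ n)"
    unfolding sum_subtractf sum_trees ..
  also have "\<dots> \<le> (\<Sum>n. real (tree_count {} n) * (y\<^sup>2) ^ n - real (tree_count {} n) * (x\<^sup>2) ^ n)"
    by (rule sum_le_suminf)
      (use assms in \<open>auto intro!: summable_diff mult_left_mono power_mono\<close>)
  also have "\<dots> = (\<Sum>n. real (tree_count {} n) * (y\<^sup>2) ^ n) - (\<Sum>n. real (tree_count {} n) * (x\<^sup>2) ^ n)"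
    by (rule suminf_diff[symmetric]) (use sm in auto)
  finally show ?thesis .
qed

text \<open>The point is uniformity in \<open>N\<close>: since \<rho> < 1, the squares y^2 stay
  inside the disc of convergence for y near \<rho>, and the generating function is continuous
  there.\<close>

lemma exists_larger_radius:
  assumes "c > 0"
  obtains y1 where "tree_radius < y1" "y1 < 1/2"
    "\<And>y N. tree_radius \<le> y \<Longrightarrow> y \<le> y1 \<Longrightarrow>
      2 * log_rem (trees {} N) y + y < 2 * log_rem (trees {} N) tree_radius + tree_radius + c"
proof -
  define r where "r = tree_radius"
  have r: "1/10 \<le> r" "r \<le> 7/18" using tree_radius_bounds by (simp_all add: r_def)
  define A where "A z = (\<Sum>n. real (tree_count {} n) * z ^ n)" for z
  \<comment> \<open>The midpoint leaves room above \<open>r\<^sup>2\<close> for y slightly beyond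
    \<rho> and stays below \<rho>, where the series converges.\<close>
  define k where "k = (r\<^sup>2 + r) / 2"
  have "r\<^sup>2 < r" using r by (simp add: power2_eq_square)
  then have k: "r\<^sup>2 < k" "k < r" by (auto simp: k_def)
  have smk: "summable (\<lambda>n. real (tree_count {} n) * z ^ n)" if "0 \<le> z" "z \<le> k" for z
    by (rule summable_below_radius) (use that k r_def in auto)
  have "0 < k" using k by (meson le_less_trans zero_le_power2)
  have "isCont A (r\<^sup>2)" unfolding A_def
    by (rule isCont_powser[OF smk[of k]]) (use k \<open>0 < k\<close> in auto)
  then have cA: "isCont (\<lambda>y. A (y\<^sup>2)) r"
    using isCont_o2[of r "\<lambda>y. y\<^sup>2" A] by simp
  then have "((\<lambda>y. 2 * (A (y\<^sup>2) - A (r\<^sup>2)) + (y - r)) \<longlongrightarrow> 2 * (A (r\<^sup>2) - A (r\<^sup>2)) + (r - r)) (nhds r)"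
    by (intro tendsto_intros filterlim_ident) (simp_all add: isCont_def tendsto_nhds_iff)
  then have e1: "eventually (\<lambda>y. 2 * (A (y\<^sup>2) - A (r\<^sup>2)) + (y - r) < c) (nhds r)"
    by (rule order_tendstoD) (use assms in simp)
  have "((\<lambda>y. y\<^sup>2) \<longlongrightarrow> r\<^sup>2) (nhds r)" by (intro tendsto_intros filterlim_ident)
  then have e2: "eventually (\<lambda>y. y\<^sup>2 < k) (nhds r)"
    by (rule order_tendstoD) (use k in simp)
  have e3: "eventually (\<lambda>y. y < 1/2) (nhds r)"
    by (rule order_tendstoD[OF filterlim_ident]) (use r in simp)
  obtain d where d: "d > 0" "\<And>y. dist y r < d \<Longrightarrow> 2 * (A (y\<^sup>2) - A (r\<^sup>2)) + (y - r) < c \<and> y\<^sup>2 < k \<and> y < 1/2"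
    using eventually_conj[OF e1 eventually_conj[OF e2 e3]] unfolding eventually_nhds_metric by auto
  show thesis
  proof (rule that[of "r + d / 2"])
    show "tree_radius < r + d / 2" using d by (simp add: r_def)
    show "r + d / 2 < 1/2" using d(1) d(2)[of "r + d/2"] by (simp add: dist_real_def)
    fix y N assume y: "tree_radius \<le> y" "y \<le> r + d / 2"
    then have "dist y r < d" using d(1) by (simp add: dist_real_def r_def)
    from d(2)[OF this] have y': "2 * (A (y\<^sup>2) - A (r\<^sup>2)) + (y - r) < c" "y\<^sup>2 < k" "y < 1/2" by auto
    have "log_rem (trees {} N) y - log_rem (trees {} N) r \<le> A (y\<^sup>2) - A (r\<^sup>2)"
      unfolding A_def by (rule log_rem_increment) (use y y' r k in \<open>auto simp: r_def[symmetric] intro!: smk\<close>)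
    then show "2 * log_rem (trees {} N) y + y < 2 * log_rem (trees {} N) tree_radius + tree_radius + c"
      using y'(1) unfolding r_def[symmetric] by argo
  qed
qed

text \<open>The missing limb \<open>F\<close> supplies the extra term y^m in
  \<open>product_lower_bound\<close>. If the logarithm of the product were ln 2, this would force 2
  ln 2 - 1 + y^m \<le> 2 R + y, which fails for all y up to some \<open>y1\<close> beyond \<rho>. So
  the barrier ln 2 is never reached and every single term is at most 1.\<close>

lemma avoiding_count_bound:
  assumes F: "adm {} F" "F = Node M0"
  obtains y1 where "tree_radius < y1" "y1 < 1/2" "\<And>n. real (tree_count {F} n) * y1 ^ n \<le> 1"
proof -
  define m where "m = leaves F"
  have rpos: "0 < tree_radius" using tree_radius_bounds by linarith
  \<comment> \<open>The gain at \<rho> is the slack that may be spent on going beyond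
    \<rho>.\<close>
  have "tree_radius ^ m > 0" using rpos by simp
  then obtain y1 where y1: "tree_radius < y1" "y1 < 1/2" and
    inc: "\<And>y N. tree_radius \<le> y \<Longrightarrow> y \<le> y1 \<Longrightarrow>
      2 * log_rem (trees {} N) y + y < 2 * log_rem (trees {} N) tree_radius + tree_radius + tree_radius ^ m"
    using exists_larger_radius by metis
  \<comment> \<open>A tree with fewer leaves than \<open>F\<close> cannot contain \<open>F\<close>;
    in particular the children of \<open>F\<close> belong to the avoiding class.\<close>
  have small: "adm {F} t" if "adm {} t" "leaves t < m" for t
    using that
  proof (induction rule: adm.induct)
    case (Node M)
    have "adm {} (Node M)" using Node by (auto simp: adm_Node_iff)
    then have "leaves t < m" if "t \<in># M" for t
      using leaves_child_less[of "{}" M t] that Node.prems by simp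
    moreover have "Node M \<noteq> F" using Node.prems by (auto simp: m_def)
    ultimately show ?case using Node by (auto simp: adm_Node_iff)
  qed (auto intro: adm.Leaf)
  have bound: "(\<Sum>t\<in>trees {F} N. y1 ^ leaves t) \<le> ln 2" if N: "N \<ge> m" for N
  proof (rule sum_le_ln_2)
    fix y assume y: "0 < y" "y \<le> y1"
    let ?b = "\<Sum>t\<in>trees {F} N. y ^ leaves t" and ?r = "log_rem (trees {F} N) y"
    assume eq: "?b + ?r = ln 2"
    have "1 + 2 * ?b - y + (\<Sum>M\<in>{M0}. y ^ leaves (Node M)) \<le> (\<Prod>t\<in>trees {F} N. 1 / (1 - y ^ leaves t))"
    proof (rule product_lower_bound)
      show "N \<ge> 1" using N leaves_pos[OF F(1)] by (simp add: m_def)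
      fix M assume "M \<in> {M0}"
      then have M: "Node M = F" using F by simp
      have "size M \<ge> 2" "\<forall>t\<in>#M. adm {} t" using F M by (auto simp: adm_Node_iff)
      moreover have "leaves t < m" if "t \<in># M" for t
        using leaves_child_less[of "{}" M t] that F M by (simp add: m_def)
      ultimately show "size M \<ge> 2 \<and> set_mset M \<subseteq> trees {F} N \<and> Node M \<notin> trees {F} N"
        using small N M by (auto simp: trees_def adm_Node_iff) (meson le_trans less_imp_le)
    qed (use y y1 in auto)
    then have "1 + 2 * ?b - y + y ^ m \<le> 2"
      using prod_eq_exp[of y "{F}" N] y y1 eq F(2) by (simp add: m_def del: leaves.simps)
    then have "2 * ln 2 - 1 + y ^ m \<le> 2 * ?r + y" using eq by linarith
    moreover have "?r \<le> log_rem (trees {} N) y"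
      by (rule log_rem_mono) (use y y1 trees_mono[of N N "{}" "{F}"] in auto)
    moreover have "2 * log_rem (trees {} N) y + y < 2 * ln 2 - 1 + y ^ m"
    proof (cases "y \<le> tree_radius")
      case True
      have "0 < y ^ m" using y by simp
      then show ?thesis using log_rem_bound_radius[of y N] True y by linarith
    next
      case False
      \<comment> \<open>Beyond \<rho> the gain only increases, so the slack computed at \<rho> still
        suffices.\<close>
      then have "tree_radius ^ m \<le> y ^ m" using rpos by (intro power_mono) auto
      then show ?thesis using inc[of y N] log_rem_bound_radius[of tree_radius N] False y rpos by linarith
    qed
    ultimately show False by linarith
  qed (use y1 rpos in auto)
  have "real (tree_count {F} n) * y1 ^ n \<le> 1" for n
  proof -
    have "real (tree_count {F} n) * y1 ^ n \<le> (\<Sum>k\<le>max n m. real (tree_count {F} k) * y1 ^ k)"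
      by (rule member_le_sum) (use y1 rpos in auto)
    also have "\<dots> \<le> ln 2" using bound[of "max n m"] by (simp add: sum_trees)
    also have "\<dots> \<le> 1" using ln2_le_25_over_36 by linarith
    finally show ?thesis .
  qed
  then show thesis using that y1 by blast
qed

section \<open>Growth of the number of all cotrees\<close>

lemma tree_count_pos:
  assumes "n \<ge> 1" shows "tree_count {} n \<ge> 1"
proof -
  have "\<exists>t. adm {} t \<and> leaves t = n"
  proof (cases "n = 1")
    case True
    then show ?thesis by (intro exI[of _ Leaf]) (auto intro: adm.Leaf)
  next
    case False
    then show ?thesis using assms
      by (intro exI[of _ "Node (replicate_mset n Leaf)"]) (auto simp: adm_Node_iff intro: adm.Leaf)
  qed
  then have "{t. adm {} t \<and> leaves t = n} \<noteq> {}" by auto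
  then have "tree_count {} n \<noteq> 0" by (simp add: tree_count_def finite_trees_eq card_eq_0_iff)
  then show ?thesis by simp
qed

text \<open>Two trees are placed under a new root. By \<open>2 * m < n\<close> they have different
  numbers of leaves, so the unordered pair of children determines the ordered one.\<close>

lemma tree_count_supermult:
  assumes "2 * m < n" shows "tree_count {} m * tree_count {} (n - m) \<le> tree_count {} n"
proof -
  let ?T = "\<lambda>n. {t. adm {} t \<and> leaves t = n}"
  have "card (?T m \<times> ?T (n - m)) \<le> card (?T n)"
  proof (rule card_inj_on_le[of "\<lambda>(s, t). Node {#s, t#}"])
    show "inj_on (\<lambda>(s, t). Node {#s, t#}) (?T m \<times> ?T (n - m))"
      using assms by (auto simp: inj_on_def add_eq_conv_ex)
    show "(\<lambda>(s, t). Node {#s, t#}) ` (?T m \<times> ?T (n - m)) \<subseteq> ?T n"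
      using assms by (auto simp: adm_Node_iff)
  qed (rule finite_trees_eq)
  then show ?thesis by (simp add: tree_count_def card_cartesian_product)
qed

text \<open>Once a term with index \<open>N\<close> is at least 1, supermultiplicativity shows that
  a step by \<open>N\<close> does not decrease the terms. A window of \<open>N\<close> consecutive
  positive terms therefore bounds all later ones from below.\<close>

lemma tree_count_lower_bound:
  assumes y: "tree_radius < y" "y < 1"
  obtains k N where "k > 0" "\<And>n. n > N \<Longrightarrow> k \<le> real (tree_count {} n) * y ^ n"
proof -
  have y0: "0 < y" using y tree_radius_bounds by linarith
  \<comment> \<open>If all terms were at most 1, comparison with a geometric series would give
    convergence at a point between \<rho> and \<open>y\<close>.\<close>
  have "\<exists>N. real (tree_count {} N) * y ^ N \<ge> 1"
  proof (rule ccontr)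
    assume "\<nexists>N. real (tree_count {} N) * y ^ N \<ge> 1"
    then have le: "real (tree_count {} n) * y ^ n \<le> 1" for n by (meson nle_le)
    obtain z where z: "tree_radius < z" "z < y" using y dense by blast
    have z0: "0 < z" using z tree_radius_bounds by linarith
    have "summable (\<lambda>n. real (tree_count {} n) * z ^ n)"
    proof (rule summable_comparison_test')
      show "summable (\<lambda>n. (z / y) ^ n)" by (rule summable_geometric) (use z z0 in auto)
      fix n
      have "real (tree_count {} n) * z ^ n = (real (tree_count {} n) * y ^ n) * (z / y) ^ n"
        using y0 by (simp add: power_divide)
      also have "\<dots> \<le> 1 * (z / y) ^ n" by (rule mult_right_mono[OF le]) (use z0 y0 in auto)
      finally show "norm (real (tree_count {} n) * z ^ n) \<le> (z / y) ^ n" using z0 by simp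
    qed
    then show False using not_summable_above_radius[of z] z y by simp
  qed
  then obtain N where N: "real (tree_count {} N) * y ^ N \<ge> 1" by blast
  have "N \<ge> 1"
  proof (rule ccontr)
    assume "\<not> N \<ge> 1"
    then have "N = 0" by simp
    moreover have "{t. adm {} t \<and> leaves t = 0} = {}" using leaves_pos by fastforce
    then have "tree_count {} 0 = 0" unfolding tree_count_def by (metis card.empty)
    ultimately show False using N by simp
  qed
  \<comment> \<open>The window ends at \<open>2 * N\<close> because
    \<open>tree_count_supermult\<close> applies only for larger indices.\<close>
  define k where "k = Min ((\<lambda>n. real (tree_count {} n) * y ^ n) ` {N<..2 * N})"
  have ne: "{N<..2 * N} \<noteq> {}" using \<open>N \<ge> 1\<close> by auto
  have "k > 0" unfolding k_def
    using ne tree_count_pos y0 by (subst Min_gr_iff) (auto simp: Suc_le_eq)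
  moreover have "k \<le> real (tree_count {} n) * y ^ n" if "n > N" for n
    using that
  proof (induction n rule: less_induct)
    case (less n)
    show ?case
    proof (cases "n \<le> 2 * N")
      case True
      then show ?thesis unfolding k_def using less.prems by (intro Min_le) auto
    next
      case False
      have "k \<le> real (tree_count {} (n - N)) * y ^ (n - N)"
        by (rule less.IH) (use False \<open>N \<ge> 1\<close> in auto)
      also have "\<dots> \<le> (real (tree_count {} N) * y ^ N) * (real (tree_count {} (n - N)) * y ^ (n - N))"
        using mult_right_mono[OF N, of "real (tree_count {} (n - N)) * y ^ (n - N)"] y0 by simp
      also have "\<dots> = real (tree_count {} N * tree_count {} (n - N)) * y ^ n"
        using False by (simp add: power_add[symmetric])
      also have "\<dots> \<le> real (tree_count {} n) * y ^ n"
        using tree_count_supermult[of N n] False y0 by (intro mult_right_mono) (auto simp del: of_nat_mult)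
      finally show ?thesis .
    qed
  qed
  ultimately show thesis using that by blast
qed

text \<open>With y strictly between \<rho> and \<open>y1\<close>, the upper bound at
  \<open>y1\<close> and the lower bound at y make the quotient decay geometrically.\<close>

theorem avoiding_fraction_tendsto_0:
  assumes "adm {} F" "F = Node M0"
  shows "(\<lambda>n. real (tree_count {F} n) / real (tree_count {} n)) \<longlonglongrightarrow> 0"
proof -
  obtain y1 where y1: "tree_radius < y1" "y1 < 1/2" "\<And>n. real (tree_count {F} n) * y1 ^ n \<le> 1"
    using avoiding_count_bound[OF assms] by metis
  obtain y where y: "tree_radius < y" "y < y1" using y1 dense by blast
  have y0: "0 < y" using y tree_radius_bounds by linarith
  obtain k N where k: "k > 0" "\<And>n. n > N \<Longrightarrow> k \<le> real (tree_count {} n) * y ^ n"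
    using tree_count_lower_bound[of y] y y1 by auto
  have "(\<lambda>n. (y / y1) ^ n / k) \<longlonglongrightarrow> 0 / k"
    by (intro tendsto_divide tendsto_const LIMSEQ_power_zero) (use y y0 k in auto)
  then have lim: "(\<lambda>n. (y / y1) ^ n / k) \<longlonglongrightarrow> 0" by simp
  have "norm (real (tree_count {F} n) / real (tree_count {} n)) \<le> (y / y1) ^ n / k" if "n > N" for n
  proof -
    have a: "real (tree_count {} n) > 0" using tree_count_pos[of n] that by simp
    have "k * (real (tree_count {F} n) * y1 ^ n) \<le> (real (tree_count {} n) * y ^ n) * 1"
      by (intro mult_mono k y1) (use that k y0 y in auto)
    then show ?thesis using a k y0 y by (simp add: field_simps power_divide)
  qed
  then show ?thesis
    by (intro Lim_null_comparison[OF _ lim] eventually_sequentiallyI[of "Suc N"]) auto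
qed

section \<open>Cographs and cotrees\<close>

text \<open>\<open>rep b t V E\<close>: the cotree \<open>t\<close>, with a join (\<open>b\<close>) or a disjoint union (\<open>\<not> b\<close>) at its root,
  describes \<open>E\<close> on the vertex set \<open>V\<close>; in \<open>parts b M V E\<close> the root may have fewer than two children.\<close>

definition cross :: "bool \<Rightarrow> nat set \<Rightarrow> nat set \<Rightarrow> (nat \<Rightarrow> nat \<Rightarrow> bool) \<Rightarrow> bool" where
  "cross b V W E \<longleftrightarrow> V \<inter> W = {} \<and> (\<forall>x\<in>V. \<forall>y\<in>W. E x y = b \<and> E y x = b)"

inductive rep and parts where
  rep_Leaf: "\<not> E v v \<Longrightarrow> rep b Leaf {v} E"
| rep_Node: "parts b M V E \<Longrightarrow> size M \<ge> 2 \<Longrightarrow> rep b (Node M) V E"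
| parts_empty: "parts b {#} {} E"
| parts_add: "parts b M V E \<Longrightarrow> rep (\<not> b) t W E \<Longrightarrow> cross b V W E \<Longrightarrow> parts b (add_mset t M) (V \<union> W) E"

lemma rep_parts_card:
  "rep b t V E \<Longrightarrow> finite V \<and> V \<noteq> {} \<and> card V = leaves t \<and> adm {} t"
  "parts b M V E \<Longrightarrow> finite V \<and> card V = leaves (Node M) \<and> (\<forall>t\<in>#M. adm {} t) \<and> (M \<noteq> {#} \<longrightarrow> V \<noteq> {})"
  by (induction rule: rep_parts.inducts)
    (auto simp: adm_Node_iff card_Un_disjoint cross_def intro: adm.Leaf)

lemma rep_parts_transport:
  "rep b t V E \<Longrightarrow> inj_on f V \<Longrightarrow> (\<And>x y. x \<in> V \<Longrightarrow> y \<in> V \<Longrightarrow> E' (f x) (f y) = E x y) \<Longrightarrow> rep b t (f ` V) E'"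
  "parts b M V E \<Longrightarrow> inj_on f V \<Longrightarrow> (\<And>x y. x \<in> V \<Longrightarrow> y \<in> V \<Longrightarrow> E' (f x) (f y) = E x y) \<Longrightarrow> parts b M (f ` V) E'"
proof (induction rule: rep_parts.inducts)
  case (parts_add b M V E t W)
  have "parts b M (f ` V) E'" "rep (\<not> b) t (f ` W) E'"
    using parts_add by (auto simp: inj_on_Un)
  moreover have "f ` (V \<inter> W) = f ` V \<inter> f ` W"
    using parts_add.prems(1) by (rule inj_on_image_Int) auto
  then have "cross b (f ` V) (f ` W) E'"
    using parts_add.hyps(3) parts_add.prems(2) by (auto simp: cross_def)
  ultimately show ?case by (auto simp: image_Un intro: rep_parts.intros)
qed (auto intro: rep_parts.intros)

lemma rep_cong:
  assumes "rep b t V E" "\<And>x y. x \<in> V \<Longrightarrow> y \<in> V \<Longrightarrow> E' x y = E x y"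
  shows "rep b t V E'"
  using rep_parts_transport(1)[OF assms(1), of id E'] assms(2) by simp

lemma parts_cong:
  assumes "parts b M V E" "\<And>x y. x \<in> V \<Longrightarrow> y \<in> V \<Longrightarrow> E' x y = E x y"
  shows "parts b M V E'"
  using rep_parts_transport(2)[OF assms(1), of id E'] assms(2) by simp

lemma rep_irrefl_sym:
  "rep b t V E \<Longrightarrow> (\<forall>x\<in>V. \<not> E x x) \<and> (\<forall>x\<in>V. \<forall>y\<in>V. E x y = E y x)"
  "parts b M V E \<Longrightarrow> (\<forall>x\<in>V. \<not> E x x) \<and> (\<forall>x\<in>V. \<forall>y\<in>V. E x y = E y x)"
  by (induction rule: rep_parts.inducts) (auto simp: cross_def)

text \<open>Complementation exchanges joins and unions on all levels, so only the root type changes.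
  The ambient set \<open>U\<close> stays fixed while the induction descends to smaller
  blocks.\<close>

lemma rep_parts_compl:
  "rep b t V E \<Longrightarrow> V \<subseteq> U \<Longrightarrow> rep (\<not> b) t V (graph_compl U E)"
  "parts b M V E \<Longrightarrow> V \<subseteq> U \<Longrightarrow> parts (\<not> b) M V (graph_compl U E)"
proof (induction rule: rep_parts.inducts)
  case (parts_add b M V E t W)
  have "cross (\<not> b) V W (graph_compl U E)"
    using parts_add by (auto simp: cross_def graph_compl_def)
  with parts_add show ?case
    by (intro rep_parts.parts_add) auto
qed (auto intro: rep_parts.intros simp: graph_compl_def)

text \<open>\<open>parts_add\<close> exposes only the child added last. Reordering makes the block
  of any chosen vertex the last one.\<close>

lemma parts_vertex:
  assumes "parts b M V E" "x \<in> V"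
  shows "\<exists>t M' W V'. M = add_mset t M' \<and> x \<in> W \<and> V = V' \<union> W \<and> rep (\<not> b) t W E \<and> cross b V' W E \<and> parts b M' V' E"
proof -
  have "\<exists>t M' W V'. M = add_mset t M' \<and> x \<in> W \<and> V = V' \<union> W \<and> rep (\<not> b) t W E \<and> cross b V' W E \<and> parts b M' V' E"
    if "size M = n" for n using that assms
  proof (induction n arbitrary: M V)
    case 0
    then show ?case by (auto elim: parts.cases)
  next
    case (Suc n)
    from Suc.prems(2) show ?case
    proof cases
      case (parts_add M1 V1 s W)
      show ?thesis
      proof (cases "x \<in> W")
        case True
        then show ?thesis using parts_add
          by (intro exI[of _ s] exI[of _ M1] exI[of _ W] exI[of _ V1]) simp
      next
        case False
        then have "x \<in> V1" using Suc.prems parts_add by auto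
        then obtain t M2 W2 V2 where *: "M1 = add_mset t M2" "x \<in> W2" "V1 = V2 \<union> W2" "rep (\<not> b) t W2 E"
          "cross b V2 W2 E" "parts b M2 V2 E"
          using Suc.IH[of M1 V1] Suc.prems parts_add by auto
        have "parts b (add_mset s M2) (V2 \<union> W) E"
          by (rule rep_parts.parts_add) (use * parts_add in \<open>auto simp: cross_def\<close>)
        moreover have "V = (V2 \<union> W) \<union> W2" using * parts_add by auto
        moreover have "cross b (V2 \<union> W) W2 E" using * parts_add by (auto simp: cross_def)
        moreover have "M = add_mset t (add_mset s M2)" using * parts_add by simp
        ultimately show ?thesis using *
          by (intro exI[of _ t] exI[of _ "add_mset s M2"] exI[of _ W2] exI[of _ "V2 \<union> W"]) simp
      qed
    qed (use Suc.prems in auto)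
  qed
  then show ?thesis by simp
qed

text \<open>The same reordering, with the last child chosen as a tree instead of through a
  vertex.\<close>

lemma parts_add_mset:
  assumes "parts b (add_mset t M) V E"
  shows "\<exists>W V'. V = V' \<union> W \<and> rep (\<not> b) t W E \<and> cross b V' W E \<and> parts b M V' E"
proof -
  have "\<exists>W V'. V = V' \<union> W \<and> rep (\<not> b) t W E \<and> cross b V' W E \<and> parts b M V' E"
    if "size M = n" for n using that assms
  proof (induction n arbitrary: M V rule: less_induct)
    case (less n)
    from less.prems(2) show ?case
    proof cases
      case (parts_add M1 V1 s W)
      show ?thesis
      proof (cases "s = t")
        case True
        then show ?thesis using parts_add by (intro exI[of _ W] exI[of _ V1]) simp
      next
        case False
        then obtain M2 where M2: "M1 = add_mset t M2" "M = add_mset s M2"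
          using parts_add by (auto simp: add_eq_conv_ex)
        then obtain W2 V2 where *: "V1 = V2 \<union> W2" "rep (\<not> b) t W2 E" "cross b V2 W2 E" "parts b M2 V2 E"
          using less.IH[of "size M2" M2 V1] less.prems parts_add by auto
        have "parts b M (V2 \<union> W) E" unfolding M2
          by (rule rep_parts.parts_add) (use * parts_add in \<open>auto simp: cross_def\<close>)
        moreover have "V = (V2 \<union> W) \<union> W2" using * parts_add by auto
        moreover have "cross b (V2 \<union> W) W2 E" using * parts_add by (auto simp: cross_def)
        ultimately show ?thesis using *
          by (intro exI[of _ W2] exI[of _ "V2 \<union> W"]) simp
      qed
    qed auto
  qed
  then show ?thesis by simp
qed

section \<open>Cotrees determine graphs up to isomorphism, and graphs determine their
  cotrees\<close>

definition isom :: "nat set \<Rightarrow> (nat \<Rightarrow> nat \<Rightarrow> bool) \<Rightarrow> nat set \<Rightarrow> (nat \<Rightarrow> nat \<Rightarrow> bool) \<Rightarrow> bool" where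
  "isom V E V' E' \<longleftrightarrow> (\<exists>f. bij_betw f V V' \<and> (\<forall>x\<in>V. \<forall>y\<in>V. E x y = E' (f x) (f y)))"

lemma isom_cross:
  assumes "isom V E V' E'" "isom W E W' E'" "cross b V W E" "cross b V' W' E'"
  shows "isom (V \<union> W) E (V' \<union> W') E'"
proof -
  obtain f g where f: "bij_betw f V V'" "\<And>x y. x \<in> V \<Longrightarrow> y \<in> V \<Longrightarrow> E x y = E' (f x) (f y)"
    and g: "bij_betw g W W'" "\<And>x y. x \<in> W \<Longrightarrow> y \<in> W \<Longrightarrow> E x y = E' (g x) (g y)"
    using assms(1,2) unfolding isom_def by blast
  define h where "h x = (if x \<in> V then f x else g x)" for x
  have disj: "V \<inter> W = {}" "V' \<inter> W' = {}" using assms by (auto simp: cross_def)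
  have "bij_betw h V V'" using f(1) by (rule bij_betw_cong[THEN iffD1, rotated]) (simp add: h_def)
  moreover have "bij_betw h W W'"
    using g(1) by (rule bij_betw_cong[THEN iffD1, rotated]) (use disj in \<open>auto simp: h_def\<close>)
  ultimately have "bij_betw h (V \<union> W) (V' \<union> W')" using disj by (intro bij_betw_combine)
  moreover have "E x y = E' (h x) (h y)" if "x \<in> V \<union> W" "y \<in> V \<union> W" for x y
  proof -
    have fV: "f x \<in> V'" if "x \<in> V" for x using f(1) that by (auto simp: bij_betw_def)
    have gW: "g x \<in> W'" if "x \<in> W" for x using g(1) that by (auto simp: bij_betw_def)
    have hW: "h x = g x" if "x \<in> W" for x using that disj by (auto simp: h_def)
    have hV: "h x = f x" if "x \<in> V" for x using that by (auto simp: h_def)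
    show ?thesis using that assms(3,4) fV gW f(2) g(2) by (auto simp: hW hV cross_def)
  qed
  ultimately show ?thesis unfolding isom_def by blast
qed

lemma parts_nonempty: "parts b M V E \<Longrightarrow> (V = {}) = (M = {#})"
  using rep_parts_card(2) by (auto elim: parts.cases)

text \<open>The same child is split off on both sides, and the isomorphisms of the two pairs of
  blocks are glued.\<close>

lemma rep_parts_isom:
  "rep b t V E \<Longrightarrow> rep b t V' E' \<Longrightarrow> isom V E V' E'"
  "parts b M V E \<Longrightarrow> parts b M V' E' \<Longrightarrow> isom V E V' E'"
proof (induction arbitrary: V' and V' rule: rep_parts.inducts)
  case (rep_Leaf E v b)
  then obtain v' where "V' = {v'}" "\<not> E' v' v'" by (auto elim: rep.cases)
  then show ?case using rep_Leaf by (auto simp: isom_def bij_betw_def intro!: exI[of _ "\<lambda>_. v'"])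
next
  case (rep_Node b M V E)
  then show ?case by (auto elim: rep.cases)
next
  case (parts_empty b E)
  then have "V' = {}" using parts_nonempty by blast
  then show ?case by (simp add: isom_def bij_betw_def)
next
  case (parts_add b M V E t W)
  obtain W2 V2 where *: "V' = V2 \<union> W2" "rep (\<not> b) t W2 E'" "cross b V2 W2 E'" "parts b M V2 E'"
    using parts_add_mset[OF parts_add.prems] by (elim exE conjE)
  show ?case unfolding *(1)
    by (rule isom_cross[OF parts_add.IH(1)[OF *(4)] parts_add.IH(2)[OF *(2)] parts_add.hyps(3) *(3)])
qed

text \<open>For nonempty \<open>W\<close> this is connectedness: of the induced graph if
  \<open>b\<close> is false, of its complement if \<open>b\<close> is true.\<close>

definition indecomp :: "bool \<Rightarrow> nat set \<Rightarrow> (nat \<Rightarrow> nat \<Rightarrow> bool) \<Rightarrow> bool" where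
  "indecomp b W E \<longleftrightarrow> (\<forall>X Y. W = X \<union> Y \<longrightarrow> cross b X Y E \<longrightarrow> X = {} \<or> Y = {})"

text \<open>For x in \<open>X\<close> with block \<open>P\<close>, all vertices of the other blocks
  \<open>R\<close> are related to x by \<not> b, so a splitting of type \<open>b\<close> must put
  them into \<open>X\<close>. As \<open>R\<close> is nonempty, the same argument from a vertex of
  \<open>R\<close> draws \<open>P\<close> into \<open>X\<close>.\<close>

lemma rep_indecomp:
  assumes "rep (\<not> b) t W E" shows "indecomp b W E"
  using assms
proof cases
  case (rep_Leaf v)
  have "X = {} \<or> Y = {}" if "{v} = X \<union> Y" "X \<inter> Y = {}" for X Y
    using that by (cases "v \<in> X") auto
  then show ?thesis using rep_Leaf by (simp add: indecomp_def cross_def)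
next
  case (rep_Node M)
  have step: "Y = {}" if XY: "W = X \<union> Y" "cross b X Y E" and x: "x \<in> X" for X Y x
  proof -
    have "x \<in> W" using XY x by simp
    then obtain t M' P R where P: "M = add_mset t M'" "x \<in> P" "W = R \<union> P" "cross (\<not> b) R P E" "parts (\<not> b) M' R E"
      using parts_vertex[OF rep_Node(2)] by blast
    have "R \<noteq> {}" using parts_nonempty[OF P(5)] rep_Node(3) P(1) by auto
    then obtain z where z: "z \<in> R" by blast
    have "R \<subseteq> X" using P XY x by (fastforce simp: cross_def)
    moreover have "P \<subseteq> X"
    proof
      fix p assume p: "p \<in> P"
      have "z \<in> X" using \<open>R \<subseteq> X\<close> z by blast
      then show "p \<in> X" using p z P XY by (fastforce simp: cross_def)
    qed
    ultimately show ?thesis using XY P by (auto simp: cross_def)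
  qed
  show ?thesis unfolding indecomp_def
  proof (intro allI impI)
    fix X Y assume XY: "W = X \<union> Y" "cross b X Y E"
    show "X = {} \<or> Y = {}"
    proof (cases "X = {}")
      case False
      then obtain x where "x \<in> X" by blast
      then show ?thesis using step[OF XY] by simp
    qed simp
  qed
qed

lemma indecomp_subset:
  assumes "indecomp b W E" "W \<subseteq> V' \<union> W'" "cross b V' W' E" "x \<in> W" "x \<in> W'"
  shows "W \<subseteq> W'"
proof -
  have "cross b (W \<inter> V') (W \<inter> W') E" using assms(3) by (auto simp: cross_def)
  moreover have "W = (W \<inter> V') \<union> (W \<inter> W')" using assms(2) by auto
  ultimately have "W \<inter> V' = {} \<or> W \<inter> W' = {}" using assms(1) unfolding indecomp_def by blast
  then show ?thesis using assms by auto
qed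

text \<open>The blocks of the root's children are indecomposable for the root type, so two blocks
  sharing a vertex in two decompositions contain each other. A single vertex is no inner node, since
  those have at least two leaves.\<close>

lemma rep_parts_unique:
  "rep b t V E \<Longrightarrow> rep b t' V E \<Longrightarrow> t = t'"
  "parts b M V E \<Longrightarrow> parts b M' V E \<Longrightarrow> M = M'"
proof (induction arbitrary: t' and M' rule: rep_parts.inducts)
  case (rep_Leaf E v b)
  from rep_Leaf.prems show ?case
  proof cases
    case (rep_Node M)
    have "card {v} = leaves (Node M)" using rep_parts_card(2)[OF rep_Node(2)] by simp
    moreover have "size M \<le> leaves (Node M)"
      by (rule size_le_leaves, rule leaves_pos[of "{}"]) (use rep_parts_card(2)[OF rep_Node(2)] in simp)
    ultimately show ?thesis using rep_Node by simp
  qed simp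
next
  case (rep_Node b M V E)
  note IH = rep_Node.IH and hyps = rep_Node.hyps
  from rep_Node.prems show ?case
  proof cases
    case (rep_Leaf v)
    have "card {v} = leaves (Node M)" using rep_parts_card(2)[OF hyps(1)] rep_Leaf by simp
    moreover have "size M \<le> leaves (Node M)"
      by (rule size_le_leaves, rule leaves_pos[of "{}"]) (use rep_parts_card(2)[OF hyps(1)] in simp)
    ultimately show ?thesis using hyps(2) by simp
  next
    case (rep_Node M')
    then show ?thesis using IH by simp
  qed
next
  case (parts_empty b E)
  then show ?case using parts_nonempty[of b M' "{}" E] by simp
next
  case (parts_add b M V E t W)
  obtain x where x: "x \<in> W" using rep_parts_card(1)[OF parts_add.hyps(2)] by blast
  obtain t2 M2 W2 V2 where *: "M' = add_mset t2 M2" "x \<in> W2" "V \<union> W = V2 \<union> W2" "rep (\<not> b) t2 W2 E" "cross b V2 W2 E"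
    "parts b M2 V2 E"
    using parts_vertex[OF parts_add.prems, of x] x by auto
  have "W \<subseteq> W2"
    by (rule indecomp_subset[OF rep_indecomp[OF parts_add.hyps(2)], of V2 W2 x]) (use * x in auto)
  moreover have "W2 \<subseteq> W"
    by (rule indecomp_subset[OF rep_indecomp[OF *(4)], of V W x]) (use * x parts_add in auto)
  ultimately have W: "W2 = W" by blast
  then have "V2 = V" using * parts_add.hyps(3) by (auto simp: cross_def)
  have "t = t2" using *(4) W by (intro parts_add.IH) simp
  moreover have "M = M2" using *(6) \<open>V2 = V\<close> by (intro parts_add.IH) simp
  ultimately show ?case using * by simp
qed

section \<open>From cographs to cotrees and back\<close>

lemma parts_Un:
  "parts b M2 V2 E \<Longrightarrow> parts b M1 V1 E \<Longrightarrow> cross b V1 V2 E \<Longrightarrow> parts b (M1 + M2) (V1 \<union> V2) E"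
proof (induction M2 arbitrary: V2)
  case empty
  then have "V2 = {}" by (simp add: parts_nonempty)
  then show ?case using empty.prems by simp
next
  case (add t M2)
  obtain W V' where *: "V2 = V' \<union> W" "rep (\<not> b) t W E" "cross b V' W E" "parts b M2 V' E"
    using parts_add_mset[OF add.prems(1)] by (elim exE conjE)
  have "parts b (M1 + M2) (V1 \<union> V') E" using add * by (auto simp: cross_def)
  then have "parts b (add_mset t (M1 + M2)) ((V1 \<union> V') \<union> W) E"
    by (rule parts_add) (use * add.prems in \<open>auto simp: cross_def\<close>)
  then show ?case using *(1) by (simp add: Un_assoc)
qed

text \<open>Under a root of type \<open>b'\<close>, a graph whose root has the other type becomes a
  single child, whereas one of the same type contributes its own children.\<close>

lemma rep_imp_parts:
  assumes "rep b t V E"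
  obtains M where "parts b' M V E" "M \<noteq> {#}"
\<comment> \<open>Comparing \<open>b\<close> with \<open>b'\<close> would misplace a single vertex,
  which is represented with both root types and must become one child.\<close>
proof (cases "rep (\<not> b') t V E")
  case True
  have "parts b' (add_mset t {#}) ({} \<union> V) E"
    by (rule parts_add) (use True in \<open>auto intro: parts_empty simp: cross_def\<close>)
  then show ?thesis using that by auto
next
  case False
  then have "b = b'" using assms by (cases b; cases b') auto
  show ?thesis
    using assms False
  proof cases
    case (rep_Leaf v)
    then show ?thesis using False rep_parts.rep_Leaf by blast
  next
    case (rep_Node M)
    then show ?thesis using that[of M] \<open>b = b'\<close> by force
  qed
qed

lemma cograph_support: "cograph V E \<Longrightarrow> E x y \<Longrightarrow> x \<in> V \<and> y \<in> V"
  by (induction arbitrary: x y rule: cograph.induct) (auto simp: graph_compl_def)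

lemma cograph_rep: "cograph V E \<Longrightarrow> \<exists>b t. rep b t V E"
proof (induction rule: cograph.induct)
  case (single v)
  then show ?case by (auto intro: rep_Leaf)
next
  case (union V1 E1 V2 E2)
  let ?E = "\<lambda>x y. E1 x y \<or> E2 x y"
  obtain b1 t1 b2 t2 where 1: "rep b1 t1 V1 E1" and 2: "rep b2 t2 V2 E2" using union by blast
  have s1: "x \<in> V1 \<and> y \<in> V1" if "E1 x y" for x y using cograph_support[OF union.hyps(1) that] .
  have s2: "x \<in> V2 \<and> y \<in> V2" if "E2 x y" for x y using cograph_support[OF union.hyps(2) that] .
  have disj: "x \<notin> V2" if "x \<in> V1" for x using that union.hyps(3) by auto
  have r1: "rep b1 t1 V1 ?E"
    by (rule rep_cong[OF 1]) (auto dest: s2 disj)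
  have r2: "rep b2 t2 V2 ?E"
    by (rule rep_cong[OF 2]) (auto dest: s1 disj)
  obtain M1 where M1: "parts False M1 V1 ?E" "M1 \<noteq> {#}" by (rule rep_imp_parts[OF r1])
  obtain M2 where M2: "parts False M2 V2 ?E" "M2 \<noteq> {#}" by (rule rep_imp_parts[OF r2])
  have "cross False V1 V2 ?E"
    unfolding cross_def using union.hyps(3) by (auto dest: s1 s2 disj)
  then have "parts False (M1 + M2) (V1 \<union> V2) ?E" by (intro parts_Un M1 M2)
  moreover have "size M1 \<ge> 1" "size M2 \<ge> 1"
    using M1 M2 by (simp_all add: Suc_leI nonempty_has_size[symmetric])
  then have "size (M1 + M2) \<ge> 2" by simp
  ultimately show ?case by (blast intro: rep_Node)
next
  case (compl V E)
  then show ?case using rep_parts_compl(1) by blast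
qed

text \<open>Cographs are generated without a join; it is the complement of the union of the
  complements.\<close>

lemma cograph_cross:
  assumes "cograph V E" "cograph W E'" "cross b V W F"
    "\<And>x y. x \<in> V \<Longrightarrow> y \<in> V \<Longrightarrow> F x y = E x y" "\<And>x y. x \<in> W \<Longrightarrow> y \<in> W \<Longrightarrow> F x y = E' x y"
    "\<And>x y. F x y \<Longrightarrow> x \<in> V \<union> W \<and> y \<in> V \<union> W" "\<And>x. \<not> F x x"
  shows "cograph (V \<union> W) F"
proof -
  have disj: "x \<notin> V \<or> x \<notin> W" for x using assms(3) by (auto simp: cross_def)
  have cr: "F x y = b \<and> F y x = b" if "x \<in> V" "y \<in> W" for x y
    using assms(3) that by (simp add: cross_def)
  show ?thesis
  proof (cases b)
    case False
    have "cograph (V \<union> W) (\<lambda>x y. E x y \<or> E' x y)"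
      by (rule cograph.union) (use assms in \<open>auto simp: cross_def\<close>)
    moreover have "(\<lambda>x y. E x y \<or> E' x y) = F"
    proof (intro ext)
      fix x y show "(E x y \<or> E' x y) = F x y"
        using assms(4-6)[of x y] cograph_support[OF assms(1), of x y] cograph_support[OF assms(2), of x y]
          disj[of x] disj[of y] cr[of x y] cr[of y x] False
        by (cases "x \<in> V"; cases "y \<in> V"; cases "x \<in> W"; cases "y \<in> W") auto
    qed
    ultimately show ?thesis by simp
  next
    case True
    let ?E = "\<lambda>x y. graph_compl V E x y \<or> graph_compl W E' x y"
    have "cograph (V \<union> W) ?E"
      by (rule cograph.union) (use assms in \<open>auto simp: cross_def intro: cograph.compl\<close>)
    then have "cograph (V \<union> W) (graph_compl (V \<union> W) ?E)" by (rule cograph.compl)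
    moreover have "graph_compl (V \<union> W) ?E = F"
    proof (intro ext)
      fix x y show "graph_compl (V \<union> W) ?E x y = F x y"
        using assms(4-6)[of x y] assms(7)[of x] disj[of x] disj[of y] cr[of x y] cr[of y x] True
        by (cases "x \<in> V"; cases "y \<in> V"; cases "x \<in> W"; cases "y \<in> W")
          (auto simp: graph_compl_def)
    qed
    ultimately show ?thesis by simp
  qed
qed

text \<open>\<open>rep\<close> ignores edges outside the vertex set, while a cograph has none there
  by \<open>cograph_support\<close>.\<close>

definition restrict_graph :: "nat set \<Rightarrow> (nat \<Rightarrow> nat \<Rightarrow> bool) \<Rightarrow> nat \<Rightarrow> nat \<Rightarrow> bool" where
  "restrict_graph V E x y \<longleftrightarrow> x \<in> V \<and> y \<in> V \<and> E x y"

lemma rep_parts_cograph: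
  "rep b t V E \<Longrightarrow> cograph V (restrict_graph V E)"
  "parts b M V E \<Longrightarrow> M \<noteq> {#} \<Longrightarrow> cograph V (restrict_graph V E)"
proof (induction rule: rep_parts.inducts)
  case (rep_Leaf E v b)
  then have "restrict_graph {v} E = (\<lambda>x y. False)" by (auto simp: restrict_graph_def fun_eq_iff)
  then show ?case by (simp add: cograph.single)
next
  case (rep_Node b M V E)
  then have "M \<noteq> {#}" by auto
  then show ?case by (rule rep_Node.IH)
next
  case (parts_add b M V E t W)
  show ?case
  proof (cases "M = {#}")
    case True
    then have "V = {}" using parts_nonempty[OF parts_add.hyps(1)] by simp
    then show ?thesis using parts_add by simp
  next
    case False
    have "\<not> E x x" if "x \<in> V \<union> W" for x
      using that rep_irrefl_sym(1)[OF parts_add.hyps(2)] rep_irrefl_sym(2)[OF parts_add.hyps(1)] by auto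
    moreover have "cross b V W (restrict_graph (V \<union> W) E)"
      using parts_add.hyps(3) by (auto simp: cross_def restrict_graph_def)
    ultimately show ?thesis
      by (intro cograph_cross[OF parts_add.IH(1)[OF False] parts_add.IH(2), of b])
        (auto simp: restrict_graph_def cross_def)
  qed
qed simp

lemma rep_exists:
  assumes "adm {} t" "finite V" "card V = leaves t"
  shows "\<exists>E. rep b t V E"
  using assms
proof (induction arbitrary: b V rule: adm.induct)
  case Leaf
  then obtain v where "V = {v}" by (auto simp: card_1_singleton_iff)
  then show ?case by (auto intro!: exI[of _ "\<lambda>_ _. False"] rep_Leaf)
next
  case (Node M)
  \<comment> \<open>The inner induction runs over submultisets of \<open>M\<close>, so that the
    outer hypothesis stays available for every child.\<close>
  have "\<exists>E. parts b M' V E" if "M' \<subseteq># M" "finite V" "card V = leaves (Node M')" for M' V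
    using that
  proof (induction M' arbitrary: V)
    case empty
    then show ?case using parts_empty by auto
  next
    case (add t M')
    have "leaves t \<le> card V" using add by simp
    then obtain W where W: "W \<subseteq> V" "card W = leaves t" "finite W"
      using obtain_subset_with_card_n by metis
    have "t \<in># M" using add.prems(1) by (meson mset_subset_eqD union_single_eq_member)
    then obtain E1 where E1: "rep (\<not> b) t W E1" using Node.IH W by blast
    have "card (V - W) = leaves (Node M')" using W add by (simp add: card_Diff_subset)
    moreover have "M' \<subseteq># M" using add.prems(1) by (meson subset_mset.order_trans mset_subset_eq_add_mset_cancel subset_mset.dual_order.trans mset_subset_eq_insertD subset_mset.less_imp_le)
    ultimately obtain E2 where E2: "parts b M' (V - W) E2" using add W by blast
    define E where "E x y = (if x \<in> W \<and> y \<in> W then E1 x y else if x \<notin> W \<and> y \<notin> W then E2 x y else b)" for x y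
    have "parts b (add_mset t M') ((V - W) \<union> W) E"
    proof (rule parts_add)
      show "parts b M' (V - W) E" by (rule parts_cong[OF E2]) (auto simp: E_def)
      show "rep (\<not> b) t W E" by (rule rep_cong[OF E1]) (auto simp: E_def)
      show "cross b (V - W) W E" by (auto simp: cross_def E_def)
    qed
    then show ?case using W by (auto simp: Un_absorb2)
  qed
  then show ?case using Node by (metis rep_Node subset_mset.order_refl)
qed

section \<open>Generalized cospectrality\<close>

text \<open>\<open>Q\<close> is a regular orthogonal matrix on \<open>V\<close> that conjugates the adjacency matrix of \<open>E\<close> into
  that of \<open>E'\<close>. Its row and column sums being 1 it commutes with the all-ones matrix, so it does the same
  for the complements and extends by the identity to any graph containing \<open>V\<close> as a module.\<close>

definition gen_similar :: "nat set \<Rightarrow> (nat \<Rightarrow> nat \<Rightarrow> bool) \<Rightarrow> (nat \<Rightarrow> nat \<Rightarrow> bool) \<Rightarrow> bool" where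
  "gen_similar V E E' \<longleftrightarrow> (\<exists>Q :: nat \<Rightarrow> nat \<Rightarrow> real.
     (\<forall>i\<in>V. \<forall>j\<in>V. (\<Sum>k\<in>V. Q i k * Q j k) = of_bool (i = j)) \<and>
     (\<forall>i\<in>V. (\<Sum>k\<in>V. Q i k) = 1) \<and> (\<forall>j\<in>V. (\<Sum>k\<in>V. Q k j) = 1) \<and>
     (\<forall>i\<in>V. \<forall>j\<in>V. (\<Sum>k\<in>V. Q i k * of_bool (E k j)) = (\<Sum>k\<in>V. of_bool (E' i k) * Q k j)))"

lemma gen_similar_cong:
  assumes "gen_similar V E E'" "\<And>x y. x \<in> V \<Longrightarrow> y \<in> V \<Longrightarrow> E1 x y = E x y"
    "\<And>x y. x \<in> V \<Longrightarrow> y \<in> V \<Longrightarrow> E1' x y = E' x y"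
  shows "gen_similar V E1 E1'"
proof -
  obtain Q :: "nat \<Rightarrow> nat \<Rightarrow> real" where Q: "\<forall>i\<in>V. \<forall>j\<in>V. (\<Sum>k\<in>V. Q i k * Q j k) = of_bool (i = j)"
    "\<forall>i\<in>V. (\<Sum>k\<in>V. Q i k) = 1" "\<forall>j\<in>V. (\<Sum>k\<in>V. Q k j) = 1"
    "\<forall>i\<in>V. \<forall>j\<in>V. (\<Sum>k\<in>V. Q i k * of_bool (E k j)) = (\<Sum>k\<in>V. of_bool (E' i k) * Q k j)"
    using assms(1) unfolding gen_similar_def by (elim exE conjE)
  have "(\<Sum>k\<in>V. Q i k * of_bool (E1 k j)) = (\<Sum>k\<in>V. of_bool (E1' i k) * Q k j)" if "i \<in> V" "j \<in> V" for i j
  proof -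
    have "(\<Sum>k\<in>V. Q i k * of_bool (E1 k j)) = (\<Sum>k\<in>V. Q i k * of_bool (E k j))"
      "(\<Sum>k\<in>V. of_bool (E1' i k) * Q k j) = (\<Sum>k\<in>V. of_bool (E' i k) * Q k j)"
      using that assms(2,3) by (auto intro!: sum.cong)
    then show ?thesis using Q(4) that by simp
  qed
  then show ?thesis unfolding gen_similar_def using Q(1-3) by (intro exI[of _ Q]) simp
qed

lemma gen_similar_transport:
  assumes "gen_similar V E E'" "inj_on f V"
    "\<And>x y. x \<in> V \<Longrightarrow> y \<in> V \<Longrightarrow> E1 (f x) (f y) = E x y"
    "\<And>x y. x \<in> V \<Longrightarrow> y \<in> V \<Longrightarrow> E1' (f x) (f y) = E' x y"
  shows "gen_similar (f ` V) E1 E1'"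
proof -
  obtain Q :: "nat \<Rightarrow> nat \<Rightarrow> real" where Q: "\<forall>i\<in>V. \<forall>j\<in>V. (\<Sum>k\<in>V. Q i k * Q j k) = of_bool (i = j)"
    "\<forall>i\<in>V. (\<Sum>k\<in>V. Q i k) = 1" "\<forall>j\<in>V. (\<Sum>k\<in>V. Q k j) = 1"
    "\<forall>i\<in>V. \<forall>j\<in>V. (\<Sum>k\<in>V. Q i k * of_bool (E k j)) = (\<Sum>k\<in>V. of_bool (E' i k) * Q k j)"
    using assms(1) unfolding gen_similar_def by (elim exE conjE)
  define g where "g = the_inv_into V f"
  have g: "g (f x) = x" if "x \<in> V" for x using that assms(2) by (simp add: g_def the_inv_into_f_f)
  show ?thesis unfolding gen_similar_def
  proof (intro exI[of _ "\<lambda>i j. Q (g i) (g j)"] conjI ballI)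
    fix i j assume "i \<in> f ` V" "j \<in> f ` V"
    then obtain i' j' where ij: "i' \<in> V" "j' \<in> V" "i = f i'" "j = f j'" by auto
    have "(i = j) = (i' = j')" using ij assms(2) by (auto simp: inj_on_def)
    then show "(\<Sum>k\<in>f ` V. Q (g i) (g k) * Q (g j) (g k)) = of_bool (i = j)"
      using Q(1) ij by (simp add: sum.reindex[OF assms(2)] g)
    show "(\<Sum>k\<in>f ` V. Q (g i) (g k) * of_bool (E1 k j)) = (\<Sum>k\<in>f ` V. of_bool (E1' i k) * Q (g k) (g j))"
      using Q(4) ij by (simp add: sum.reindex[OF assms(2)] g assms(3,4))
  next
    fix i assume "i \<in> f ` V"
    then show "(\<Sum>k\<in>f ` V. Q (g i) (g k)) = 1" "(\<Sum>k\<in>f ` V. Q (g k) (g i)) = 1"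
      using Q(2,3) by (auto simp: sum.reindex[OF assms(2)] g)
  qed
qed

lemma gen_similar_compl:
  assumes "gen_similar V E E'" "finite V" "V \<subseteq> U" "\<And>x. x \<in> V \<Longrightarrow> \<not> E x x \<and> \<not> E' x x"
  shows "gen_similar V (graph_compl U E) (graph_compl U E')"
proof -
  obtain Q :: "nat \<Rightarrow> nat \<Rightarrow> real" where Q: "\<forall>i\<in>V. \<forall>j\<in>V. (\<Sum>k\<in>V. Q i k * Q j k) = of_bool (i = j)"
    "\<forall>i\<in>V. (\<Sum>k\<in>V. Q i k) = 1" "\<forall>j\<in>V. (\<Sum>k\<in>V. Q k j) = 1"
    "\<forall>i\<in>V. \<forall>j\<in>V. (\<Sum>k\<in>V. Q i k * of_bool (E k j)) = (\<Sum>k\<in>V. of_bool (E' i k) * Q k j)"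
    using assms(1) unfolding gen_similar_def by (elim exE conjE)
  have "(\<Sum>k\<in>V. Q i k * of_bool (graph_compl U E k j)) = (\<Sum>k\<in>V. of_bool (graph_compl U E' i k) * Q k j)"
    if ij: "i \<in> V" "j \<in> V" for i j
  proof -
    have "(\<Sum>k\<in>V. Q i k * of_bool (graph_compl U E k j)) =
        (\<Sum>k\<in>V. Q i k - (if k = j then Q i k else 0) - Q i k * of_bool (E k j))"
      by (intro sum.cong) (use ij assms(3,4) in \<open>auto simp: graph_compl_def\<close>)
    also have "\<dots> = 1 - Q i j - (\<Sum>k\<in>V. of_bool (E' i k) * Q k j)"
      using Q ij assms(2) by (simp add: sum_subtractf)
    also have "\<dots> = (\<Sum>k\<in>V. Q k j - (if k = i then Q k j else 0) - of_bool (E' i k) * Q k j)"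
      using Q ij assms(2) by (simp add: sum_subtractf)
    also have "\<dots> = (\<Sum>k\<in>V. of_bool (graph_compl U E' i k) * Q k j)"
      by (intro sum.cong) (use ij assms(3,4) in \<open>auto simp: graph_compl_def\<close>)
    finally show ?thesis .
  qed
  then show ?thesis unfolding gen_similar_def using Q(1-3) by (intro exI[of _ Q]) simp
qed

lemma sum_of_bool_eq:
  fixes h :: "'a \<Rightarrow> real"
  assumes "finite A" "i \<in> A"
  shows "(\<Sum>k\<in>A. of_bool (i = k) * h k) = h i" "(\<Sum>k\<in>A. h k * of_bool (k = i)) = h i"
    "(\<Sum>k\<in>A. h k * of_bool (i = k)) = h i"
    "(\<Sum>k\<in>A. of_bool (i = k)) = (1::real)" "(\<Sum>k\<in>A. of_bool (k = i)) = (1::real)"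
proof -
  have *: "(\<Sum>k\<in>A. g k) = g i" if "\<And>k. k \<noteq> i \<Longrightarrow> g k = 0" for g :: "'a \<Rightarrow> real"
  proof -
    have "(\<Sum>k\<in>A. g k) = g i + (\<Sum>k\<in>A - {i}. g k)" by (rule sum.remove[OF assms])
    also have "(\<Sum>k\<in>A - {i}. g k) = 0" by (rule sum.neutral) (use that in auto)
    finally show ?thesis by simp
  qed
  show "(\<Sum>k\<in>A. of_bool (i = k) * h k) = h i"
    using *[of "\<lambda>k. of_bool (i = k) * h k"] by simp
  show "(\<Sum>k\<in>A. h k * of_bool (k = i)) = h i"
    using *[of "\<lambda>k. h k * of_bool (k = i)"] by simp
  show "(\<Sum>k\<in>A. h k * of_bool (i = k)) = h i"
    using *[of "\<lambda>k. h k * of_bool (i = k)"] by simp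
  show "(\<Sum>k\<in>A. of_bool (i = k)) = (1::real)"
    using *[of "\<lambda>k. of_bool (i = k)"] by simp
  show "(\<Sum>k\<in>A. of_bool (k = i)) = (1::real)"
    using *[of "\<lambda>k. of_bool (k = i)"] by simp
qed

text \<open>The witness is block diagonal, with the identity on \<open>R\<close> and
  \<open>Q\<close> on \<open>W\<close>. The blocks of the adjacency matrices between
  \<open>R\<close> and \<open>W\<close> are constant, and \<open>Q\<close> fixes them because its
  row and column sums are 1.\<close>

lemma gen_similar_module:
  assumes "gen_similar W E E'" "finite W" "finite R" "cross b R W E" "cross b R W E'"
    "\<And>x y. x \<in> R \<Longrightarrow> y \<in> R \<Longrightarrow> E' x y = E x y"
  shows "gen_similar (R \<union> W) E E'"
proof -
  obtain Q :: "nat \<Rightarrow> nat \<Rightarrow> real" where Q: "\<forall>i\<in>W. \<forall>j\<in>W. (\<Sum>k\<in>W. Q i k * Q j k) = of_bool (i = j)"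
    "\<forall>i\<in>W. (\<Sum>k\<in>W. Q i k) = 1" "\<forall>j\<in>W. (\<Sum>k\<in>W. Q k j) = 1"
    "\<forall>i\<in>W. \<forall>j\<in>W. (\<Sum>k\<in>W. Q i k * of_bool (E k j)) = (\<Sum>k\<in>W. of_bool (E' i k) * Q k j)"
    using assms(1) unfolding gen_similar_def by (elim exE conjE)
  define P where "P i j = (if i \<in> W \<and> j \<in> W then Q i j else of_bool (i = j))" for i j
  have disj: "R \<inter> W = {}" using assms(4) by (simp add: cross_def)
  have PW: "P i j = Q i j" if "i \<in> W" "j \<in> W" for i j using that by (simp add: P_def)
  have PR: "P i j = of_bool (i = j)" if "i \<in> R \<or> j \<in> R" for i j using that disj by (auto simp: P_def)
  have ne: "i \<noteq> j" if "i \<in> R" "j \<in> W" for i j using that disj by auto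
  have sp: "(\<Sum>k\<in>R \<union> W. h k) = (\<Sum>k\<in>R. h k) + (\<Sum>k\<in>W. h k)" for h :: "nat \<Rightarrow> real"
    using assms(2,3) disj by (simp add: sum.union_disjoint)
  have cr: "E x y = b" "E y x = b" "E' x y = b" "E' y x = b" if "x \<in> R" "y \<in> W" for x y
    using that assms(4,5) by (auto simp: cross_def)
  note d = sum_of_bool_eq[OF assms(3)]
  have z: "(\<Sum>k\<in>A. h k) = 0" if "\<And>k. k \<in> A \<Longrightarrow> h k = 0" for h :: "nat \<Rightarrow> real" and A :: "nat set"
    using that by simp
  show ?thesis unfolding gen_similar_def
  proof (intro exI[of _ P] conjI ballI)
    fix i j assume i: "i \<in> R \<union> W" and j: "j \<in> R \<union> W"
    show "(\<Sum>k\<in>R \<union> W. P i k * P j k) = of_bool (i = j)"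
      using i j Q(1) ne ne[THEN not_sym] d(1)[of i "\<lambda>k. of_bool (j = k)"] unfolding sp
      by (elim UnE) (auto simp: PW PR ne)
    have lhs: "(\<Sum>k\<in>R \<union> W. P i k * of_bool (E k j)) =
      (if i \<in> R then of_bool (E i j) else if j \<in> R then of_bool b else (\<Sum>k\<in>W. Q i k * of_bool (E k j)))"
    proof (cases "i \<in> R")
      case True
      then have "(\<Sum>k\<in>R. P i k * of_bool (E k j)) = of_bool (E i j)" by (simp add: PR d)
      moreover have "(\<Sum>k\<in>W. P i k * of_bool (E k j)) = 0"
        by (rule z) (use True ne in \<open>auto simp: PR\<close>)
      ultimately show ?thesis using True by (simp add: sp)
    next
      case False
      then have iW: "i \<in> W" using i by simp
      have 1: "(\<Sum>k\<in>R. P i k * of_bool (E k j)) = 0"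
        by (rule z) (use iW ne in \<open>auto simp: PR\<close>)
      have "(\<Sum>k\<in>W. P i k * of_bool (E k j)) = (\<Sum>k\<in>W. Q i k * of_bool (E k j))"
        using iW by (simp add: PW)
      moreover have "\<dots> = of_bool b" if "j \<in> R"
      proof -
        have "(\<Sum>k\<in>W. Q i k * of_bool (E k j)) = (\<Sum>k\<in>W. Q i k) * of_bool b"
          unfolding sum_distrib_right by (intro sum.cong) (use that cr in auto)
        then show ?thesis using Q(2) iW by simp
      qed
      ultimately show ?thesis using 1 False by (simp add: sp)
    qed
    have rhs: "(\<Sum>k\<in>R \<union> W. of_bool (E' i k) * P k j) =
      (if j \<in> R then of_bool (E' i j) else if i \<in> R then of_bool b else (\<Sum>k\<in>W. of_bool (E' i k) * Q k j))"
    proof (cases "j \<in> R")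
      case True
      then have "(\<Sum>k\<in>R. of_bool (E' i k) * P k j) = of_bool (E' i j)" by (simp add: PR d)
      moreover have "(\<Sum>k\<in>W. of_bool (E' i k) * P k j) = 0"
        by (rule z) (use True ne in \<open>auto simp: PR\<close>)
      ultimately show ?thesis using True by (simp add: sp)
    next
      case False
      then have jW: "j \<in> W" using j by simp
      have 1: "(\<Sum>k\<in>R. of_bool (E' i k) * P k j) = 0"
        by (rule z) (use jW ne in \<open>auto simp: PR\<close>)
      have "(\<Sum>k\<in>W. of_bool (E' i k) * P k j) = (\<Sum>k\<in>W. of_bool (E' i k) * Q k j)"
        using jW by (simp add: PW)
      moreover have "\<dots> = of_bool b" if "i \<in> R"
      proof -
        have "(\<Sum>k\<in>W. of_bool (E' i k) * Q k j) = of_bool b * (\<Sum>k\<in>W. Q k j)"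
          unfolding sum_distrib_left by (intro sum.cong) (use that cr in auto)
        then show ?thesis using Q(3) jW by simp
      qed
      ultimately show ?thesis using 1 False by (simp add: sp)
    qed
    show "(\<Sum>k\<in>R \<union> W. P i k * of_bool (E k j)) = (\<Sum>k\<in>R \<union> W. of_bool (E' i k) * P k j)"
      unfolding lhs rhs using i j Q(4) cr[of i j] cr[of j i] assms(6)[of i j] by auto
  next
    fix i assume i: "i \<in> R \<union> W"
    have zR: "(\<Sum>k\<in>R. of_bool (i = k)) = (0::real)" "(\<Sum>k\<in>R. of_bool (k = i)) = (0::real)" if "i \<in> W"
      by (rule z, use that ne in auto)+
    have zW: "(\<Sum>k\<in>W. of_bool (i = k)) = (0::real)" "(\<Sum>k\<in>W. of_bool (k = i)) = (0::real)" if "i \<in> R"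
      by (rule z, use that ne in auto)+
    show "(\<Sum>k\<in>R \<union> W. P i k) = 1"
      using i Q(2) ne unfolding sp by (elim UnE) (auto simp: PW PR d zR zW)
    show "(\<Sum>k\<in>R \<union> W. P k i) = 1"
      using i Q(3) ne unfolding sp by (elim UnE) (auto simp: PW PR d zR zW)
  qed
qed

text \<open>For a square matrix, orthonormal rows make the transpose a two-sided inverse. The
  adjacency matrices are then similar over the reals, and equality of characteristic polynomials
  carries over to the complex numbers.\<close>

lemma gen_similar_Spec:
  assumes "gen_similar {0..<n} E E'" shows "Spec n E' = Spec n E"
proof -
  let ?V = "{0..<n}"
  obtain Q :: "nat \<Rightarrow> nat \<Rightarrow> real" where Q: "\<forall>i\<in>?V. \<forall>j\<in>?V. (\<Sum>k\<in>?V. Q i k * Q j k) = of_bool (i = j)"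
    "\<forall>i\<in>?V. \<forall>j\<in>?V. (\<Sum>k\<in>?V. Q i k * of_bool (E k j)) = (\<Sum>k\<in>?V. of_bool (E' i k) * Q k j)"
    using assms unfolding gen_similar_def by (elim exE conjE)
  define P where "P = Matrix.mat n n (\<lambda>(i, j). Q i j)"
  define A where "A = adj_mat n E"
  define B where "B = adj_mat n E'"
  have c: "P \<in> carrier_mat n n" "A \<in> carrier_mat n n" "B \<in> carrier_mat n n"
    by (auto simp: P_def A_def B_def adj_mat_def)
  have PT: "P * transpose_mat P = 1\<^sub>m n"
  proof (rule eq_matI)
    fix i j assume "i < dim_row (1\<^sub>m n :: real mat)" "j < dim_col (1\<^sub>m n :: real mat)"
    then show "(P * transpose_mat P) $$ (i, j) = 1\<^sub>m n $$ (i, j)"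
      using Q(1) by (simp add: P_def scalar_prod_def)
  qed (auto simp: P_def)
  then have TP: "transpose_mat P * P = 1\<^sub>m n"
    using c by (intro mat_mult_left_right_inverse[of P n "transpose_mat P"]) auto
  have PA: "P * A = B * P"
  proof (rule eq_matI)
    fix i j assume "i < dim_row (B * P)" "j < dim_col (B * P)"
    then have ij: "i < n" "j < n" using c by auto
    have "(P * A) $$ (i, j) = (\<Sum>k\<in>?V. Q i k * of_bool (E k j))"
      using ij by (auto simp: P_def A_def adj_mat_def scalar_prod_def of_bool_def intro!: sum.cong)
    moreover have "(B * P) $$ (i, j) = (\<Sum>k\<in>?V. of_bool (E' i k) * Q k j)"
      using ij by (auto simp: P_def B_def adj_mat_def scalar_prod_def of_bool_def intro!: sum.cong)
    ultimately show "(P * A) $$ (i, j) = (B * P) $$ (i, j)" using Q(2) ij by simp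
  qed (use c in auto)
  have "P * A * transpose_mat P = B * (P * transpose_mat P)"
    unfolding PA using c by (intro assoc_mult_mat) auto
  then have "similar_mat_wit B A P (transpose_mat P)"
    using PT TP c by (intro similar_mat_witI) auto
  then have "char_poly B = char_poly A"
    by (intro char_poly_similar) (auto simp: similar_mat_def)
  moreover have "char_poly (map_mat complex_of_real M) = map_poly complex_of_real (char_poly M)"
    if "M \<in> carrier_mat n n" for M
    using that by (rule of_real_hom.char_poly_hom)
  ultimately show ?thesis unfolding Spec_def using c by (simp add: A_def B_def)
qed

section \<open>A generalized cospectral pair\<close>

definition star :: "nat \<Rightarrow> tree" where
  "star n = Node (replicate_mset n Leaf)"

text \<open>\<open>limb1\<close> is the cotree of \<open>K\<^sub>3 + (K\<^sub>1 join (2 K\<^sub>2 + (K\<^sub>4 join 4 K\<^sub>1)))\<close> and \<open>limb2\<close> that of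
  \<open>(K\<^sub>1 join 4 K\<^sub>1) + (K\<^sub>3 join (2 K\<^sub>2 + K\<^sub>4))\<close>, a generalized cospectral pair found by computer search; a
  \<open>star n\<close> child contributes \<open>K\<^sub>n\<close> or \<open>n K\<^sub>1\<close> depending on its level.\<close>

definition limb1_children :: "tree multiset" where
  "limb1_children = {#star 3, Node {#Leaf, Node {#star 2, star 2, Node (add_mset (star 4) (replicate_mset 4 Leaf))#}#}#}"

definition limb1 :: tree where "limb1 = Node limb1_children"

definition limb2 :: tree where
  "limb2 = Node {#Node {#Leaf, star 4#}, Node (add_mset (Node {#star 2, star 2, star 4#}) (replicate_mset 3 Leaf))#}"

text \<open>The cells 0 to 4 have sizes 3, 1, 4, 4, 4 and induce \<open>K\<^sub>3\<close>,
  \<open>K\<^sub>1\<close>, \<open>2 K\<^sub>2\<close>, \<open>K\<^sub>4\<close> and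
  \<open>4 K\<^sub>1\<close> in both graphs.\<close>

definition cell :: "nat \<Rightarrow> nat" where
  "cell x = (if x < 3 then 0 else if x < 4 then 1 else if x < 8 then 2 else if x < 12 then 3 else 4)"

definition cell_adj :: "nat \<Rightarrow> nat \<Rightarrow> bool" where
  "cell_adj x y \<longleftrightarrow> x \<noteq> y \<and> cell x = cell y \<and> (cell x = 0 \<or> cell x = 3 \<or> cell x = 2 \<and> x div 2 = y div 2)"

definition joined1 :: "nat \<Rightarrow> nat \<Rightarrow> bool" where
  "joined1 c d \<longleftrightarrow> {c, d} \<in> {{1, 2}, {1, 3}, {1, 4}, {3, 4}}"

definition joined2 :: "nat \<Rightarrow> nat \<Rightarrow> bool" where
  "joined2 c d \<longleftrightarrow> {c, d} \<in> {{1, 4}, {0, 2}, {0, 3}}"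

definition graph1 :: "nat \<Rightarrow> nat \<Rightarrow> bool" where
  "graph1 x y \<longleftrightarrow> cell_adj x y \<or> joined1 (cell x) (cell y)"

definition graph2 :: "nat \<Rightarrow> nat \<Rightarrow> bool" where
  "graph2 x y \<longleftrightarrow> cell_adj x y \<or> joined2 (cell x) (cell y)"

lemma parts_Leafs:
  assumes "finite V" "card V = n" "\<forall>x\<in>V. \<forall>y\<in>V. E x y = (b \<and> x \<noteq> y)"
  shows "parts b (replicate_mset n Leaf) V E"
  unfolding assms(2)[symmetric] using assms(1,3)
proof (induction V rule: finite_induct)
  case empty
  then show ?case by (simp add: parts_empty)
next
  case (insert v V)
  have "parts b (add_mset Leaf (replicate_mset (card V) Leaf)) (V \<union> {v}) E"
  proof (rule parts_add)
    show "parts b (replicate_mset (card V) Leaf) V E" using insert by auto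
    show "rep (\<not> b) Leaf {v} E" by (rule rep_Leaf) (use insert.prems in auto)
    show "cross b V {v} E" using insert by (auto simp: cross_def)
  qed
  then show ?case using insert.hyps by simp
qed

lemma parts_single: "rep (\<not> b) t V E \<Longrightarrow> parts b {#t#} V E"
  using parts_add[OF parts_empty, of b t V E] by (simp add: cross_def)

lemma rep_star:
  assumes "finite V" "card V = n" "n \<ge> 2" "\<forall>x\<in>V. \<forall>y\<in>V. E x y = (b \<and> x \<noteq> y)"
  shows "rep b (star n) V E"
  unfolding star_def by (rule rep_Node[OF parts_Leafs[OF assms(1,2,4)]]) (use assms in simp)

lemmas graph_defs = cross_def graph1_def graph2_def joined1_def joined2_def cell_adj_def cell_def doubleton_eq_iff

lemma interval_16: "{0..<16::nat} = {0, 1, 2, 3, 4, 5, 6, 7, 8, 9, 10, 11, 12, 13, 14, 15}"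
  by (auto, presburger)

lemma rep_limb1: "rep False limb1 {0..<16} graph1"
proof -
  have s0: "rep True (star 3) {0, 1, 2} graph1"
    by (rule rep_star, simp_all add: graph_defs)
  have s1: "parts True {#Leaf#} {3} graph1"
    by (rule parts_single, rule rep_Leaf) (simp add: graph_defs)
  have s2: "rep True (star 2) {4, 5} graph1" "rep True (star 2) {6, 7} graph1"
    by (rule rep_star, simp_all add: graph_defs)+
  have s3: "parts True (replicate_mset 4 Leaf) {8, 9, 10, 11} graph1"
    by (rule parts_Leafs, simp_all add: graph_defs)
  have s4: "rep False (star 4) {12, 13, 14, 15} graph1"
    by (rule rep_star, simp_all add: graph_defs)
  have a: "parts True (add_mset (star 4) (replicate_mset 4 Leaf)) ({8, 9, 10, 11} \<union> {12, 13, 14, 15}) graph1"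
    by (rule parts_add[OF s3]) (use s4 in \<open>simp_all add: graph_defs\<close>)
  have b: "parts False {#star 2, star 2, Node (add_mset (star 4) (replicate_mset 4 Leaf))#}
      ({8, 9, 10, 11} \<union> {12, 13, 14, 15} \<union> {6, 7} \<union> {4, 5}) graph1"
    by (rule parts_add[OF parts_add[OF parts_single]])
      (use s2 rep_Node[OF a] in \<open>simp_all add: graph_defs\<close>)
  have c: "parts True {#Node {#star 2, star 2, Node (add_mset (star 4) (replicate_mset 4 Leaf))#}, Leaf#}
      ({3} \<union> ({8, 9, 10, 11} \<union> {12, 13, 14, 15} \<union> {6, 7} \<union> {4, 5})) graph1"
    by (rule parts_add[OF s1]) (use rep_Node[OF b] in \<open>simp_all add: graph_defs\<close>)
  have d: "parts False {#star 3, Node {#Node {#star 2, star 2, Node (add_mset (star 4) (replicate_mset 4 Leaf))#}, Leaf#}#}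
      (({3} \<union> ({8, 9, 10, 11} \<union> {12, 13, 14, 15} \<union> {6, 7} \<union> {4, 5})) \<union> {0, 1, 2}) graph1"
    by (rule parts_add[OF parts_single]) (use s0 rep_Node[OF c] in \<open>simp_all add: graph_defs\<close>)
  have "({3} \<union> ({8, 9, 10, 11} \<union> {12, 13, 14, 15} \<union> {6, 7} \<union> {4, 5})) \<union> {0, 1, 2} = {0..<16::nat}"
    unfolding interval_16 by auto
  with rep_Node[OF d] show ?thesis by (simp add: limb1_def limb1_children_def add_mset_commute)
qed

lemma rep_limb2: "rep False limb2 {0..<16} graph2"
proof -
  have s0: "parts True (replicate_mset 3 Leaf) {0, 1, 2} graph2"
    by (rule parts_Leafs, simp_all add: graph_defs)
  have s1: "parts True {#Leaf#} {3} graph2"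
    by (rule parts_single, rule rep_Leaf) (simp add: graph_defs)
  have s2: "rep True (star 2) {4, 5} graph2" "rep True (star 2) {6, 7} graph2"
    by (rule rep_star, simp_all add: graph_defs)+
  have s3: "rep True (star 4) {8, 9, 10, 11} graph2"
    by (rule rep_star, simp_all add: graph_defs)
  have s4: "rep False (star 4) {12, 13, 14, 15} graph2"
    by (rule rep_star, simp_all add: graph_defs)
  have a: "parts False {#star 2, star 2, star 4#} ({8, 9, 10, 11} \<union> {6, 7} \<union> {4, 5}) graph2"
    by (rule parts_add[OF parts_add[OF parts_single]])
      (use s2 s3 in \<open>simp_all add: graph_defs\<close>)
  have b: "parts True (add_mset (Node {#star 2, star 2, star 4#}) (replicate_mset 3 Leaf))
      ({0, 1, 2} \<union> ({8, 9, 10, 11} \<union> {6, 7} \<union> {4, 5})) graph2"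
    by (rule parts_add[OF s0]) (use rep_Node[OF a] in \<open>simp_all add: graph_defs\<close>)
  have c: "parts True {#star 4, Leaf#} ({3} \<union> {12, 13, 14, 15}) graph2"
    by (rule parts_add[OF s1]) (use s4 in \<open>simp_all add: graph_defs\<close>)
  have d: "parts False {#Node {#star 4, Leaf#}, Node (add_mset (Node {#star 2, star 2, star 4#}) (replicate_mset 3 Leaf))#}
      (({0, 1, 2} \<union> ({8, 9, 10, 11} \<union> {6, 7} \<union> {4, 5})) \<union> ({3} \<union> {12, 13, 14, 15})) graph2"
    by (rule parts_add[OF parts_single]) (use rep_Node[OF b] rep_Node[OF c] in \<open>simp_all add: graph_defs\<close>)
  have "({0, 1, 2} \<union> ({8, 9, 10, 11} \<union> {6, 7} \<union> {4, 5})) \<union> ({3} \<union> {12, 13, 14, 15}) = {0..<16::nat}"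
    unfolding interval_16 by auto
  with rep_Node[OF d] show ?thesis by (simp add: limb2_def add_mset_commute)
qed

text \<open>Both graphs split into the same five cells, inducing isomorphic regular graphs and differing only in
  which cells are joined. \<open>weight\<close> is the cell-constant part of an orthogonal matrix that maps one
  quotient matrix to the other.\<close>

definition weight :: "nat \<Rightarrow> nat \<Rightarrow> real" where
  "weight c d = [[-12, 12, -2, 10, -2], [12, -12, 2, -10, 2], [6, -6, -13, 2, 8],
     [-6, 6, 6, -9, 6], [6, -6, 8, 2, -13]] ! c ! d / 42"

text \<open>Degrees inside the cells, each of which induces a regular graph.\<close>

definition inner_degree :: "nat \<Rightarrow> real" where
  "inner_degree c = [2, 0, 1, 3, 0] ! c"

text \<open>The coefficients are the cell sizes.\<close>

definition cell_sum :: "(nat \<Rightarrow> real) \<Rightarrow> real" where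
  "cell_sum f = 3 * f 0 + f 1 + 4 * f 2 + 4 * f 3 + 4 * f 4"

lemma sum_cell: "(\<Sum>k\<in>{0..<16}. f (cell k)) = cell_sum f"
  unfolding interval_16 by (simp add: cell_def cell_sum_def)

lemma cell_less: "cell x < 5"
  by (simp add: cell_def)

lemma cell_cases:
  assumes "c < 5" obtains "c = 0" | "c = 1" | "c = 2" | "c = 3" | "c = (4::nat)"
  using assms by linarith

lemma cell_adj_sym: "cell_adj x y = cell_adj y x"
  by (auto simp: cell_adj_def)

lemma sum_cell_adj:
  assumes "j \<in> {0..<16}"
  shows "(\<Sum>k\<in>{0..<16}. h (cell k) * of_bool (cell_adj k j)) = h (cell j) * inner_degree (cell j)"
proof -
  have "(\<Sum>k\<in>{0..<16}. of_bool (cell_adj k j)) = inner_degree (cell j)"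
    using assms unfolding interval_16
    by (elim insertE emptyE) (simp_all add: cell_adj_def cell_def inner_degree_def)
  moreover have "(\<Sum>k\<in>{0..<16}. h (cell k) * of_bool (cell_adj k j)) = (\<Sum>k\<in>{0..<16}. h (cell j) * of_bool (cell_adj k j))"
    by (intro sum.cong) (auto simp: cell_adj_def)
  ultimately show ?thesis by (simp add: sum_distrib_left[symmetric])
qed

text \<open>For Q = I + w with w constant on pairs of cells, Q Q^T = I amounts to w + w^T + w w^T =
  0. This is checked for all 25 pairs of cells.\<close>

lemma weight_orthogonal:
  "c < 5 \<Longrightarrow> d < 5 \<Longrightarrow> weight c d + weight d c + cell_sum (\<lambda>e. weight c e * weight d e) = 0"
  by (elim cell_cases[of c] cell_cases[of d]) (simp_all add: weight_def cell_sum_def)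

lemma weight_sums:
  "c < 5 \<Longrightarrow> cell_sum (\<lambda>e. weight c e) = 0" "c < 5 \<Longrightarrow> cell_sum (\<lambda>e. weight e c) = 0"
  by (elim cell_cases[of c], simp_all add: weight_def cell_sum_def)+

text \<open>An entry of Q A1 = A2 Q after cancelling the common adjacency inside cells: by
  regularity, what remains depends only on the two cells.\<close>

lemma weight_intertwines:
  "c < 5 \<Longrightarrow> d < 5 \<Longrightarrow>
   of_bool (joined1 c d) + weight c d * inner_degree d + cell_sum (\<lambda>e. weight c e * of_bool (joined1 e d)) =
   of_bool (joined2 c d) + inner_degree c * weight c d + cell_sum (\<lambda>e. of_bool (joined2 c e) * weight e d)"
  by (elim cell_cases[of c] cell_cases[of d])
    (simp_all add: weight_def cell_sum_def inner_degree_def joined1_def joined2_def doubleton_eq_iff)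

lemma not_joined:
  assumes "cell_adj x y" shows "\<not> joined1 (cell x) (cell y)" "\<not> joined2 (cell x) (cell y)"
proof -
  have "cell x = cell y" using assms by (simp add: cell_adj_def)
  then show "\<not> joined1 (cell x) (cell y)" "\<not> joined2 (cell x) (cell y)"
    by (auto simp: joined1_def joined2_def doubleton_eq_iff)
qed

lemma gen_similar_limbs: "gen_similar {0..<16} graph1 graph2"
proof -
  define V where "V = {0..<16::nat}"
  have finV: "finite V" by (simp add: V_def)
  note sum_cell = sum_cell[folded V_def] and sum_cell_adj = sum_cell_adj[folded V_def]
  define Q where "Q i j = of_bool (i = j) + weight (cell i) (cell j)" for i j
  note d = sum_of_bool_eq[OF finV]
  have g1: "of_bool (graph1 x y) = (of_bool (cell_adj x y) + of_bool (joined1 (cell x) (cell y)) :: real)" for x y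
    using not_joined(1)[of x y] by (cases "cell_adj x y") (simp_all add: graph1_def)
  have g2: "of_bool (graph2 x y) = (of_bool (cell_adj x y) + of_bool (joined2 (cell x) (cell y)) :: real)" for x y
    using not_joined(2)[of x y] by (cases "cell_adj x y") (simp_all add: graph2_def)
  have c: "cell x < 5" for x by (rule cell_less)
  show ?thesis unfolding gen_similar_def V_def[symmetric]
  proof (intro exI[of _ Q] conjI ballI)
    fix i j assume i: "i \<in> V" and j: "j \<in> V"
    have "(\<Sum>k\<in>V. Q i k * Q j k) = (\<Sum>k\<in>V. of_bool (i = k) * Q j k)
        + (\<Sum>k\<in>V. weight (cell i) (cell k) * of_bool (j = k)) + (\<Sum>k\<in>V. weight (cell i) (cell k) * weight (cell j) (cell k))"
      by (simp add: Q_def algebra_simps sum.distrib)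
    also have "\<dots> = of_bool (i = j) + (weight (cell j) (cell i) + weight (cell i) (cell j)
        + cell_sum (\<lambda>e. weight (cell i) e * weight (cell j) e))"
      using i j d sum_cell[of "\<lambda>e. weight (cell i) e * weight (cell j) e"] by (simp add: Q_def eq_commute[of j i])
    finally show "(\<Sum>k\<in>V. Q i k * Q j k) = of_bool (i = j)"
      using weight_orthogonal[OF c c, of i j] by simp
    have "(\<Sum>k\<in>V. Q i k * of_bool (graph1 k j)) = (\<Sum>k\<in>V. of_bool (i = k) * of_bool (graph1 k j))
        + (\<Sum>k\<in>V. weight (cell i) (cell k) * of_bool (cell_adj k j))
        + (\<Sum>k\<in>V. weight (cell i) (cell k) * of_bool (joined1 (cell k) (cell j)))"
      by (simp add: Q_def g1 distrib_left distrib_right sum.distrib add.assoc)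
    also have "\<dots> = of_bool (cell_adj i j) + (of_bool (joined1 (cell i) (cell j)) + weight (cell i) (cell j) * inner_degree (cell j)
        + cell_sum (\<lambda>e. weight (cell i) e * of_bool (joined1 e (cell j))))"
      using d(1)[OF i, of "\<lambda>k. of_bool (graph1 k j)"] sum_cell_adj[OF j, of "weight (cell i)"]
        sum_cell[of "\<lambda>e. weight (cell i) e * of_bool (joined1 e (cell j))"] by (simp add: g1)
    also have "\<dots> = of_bool (cell_adj i j) + (of_bool (joined2 (cell i) (cell j)) + inner_degree (cell i) * weight (cell i) (cell j)
        + cell_sum (\<lambda>e. of_bool (joined2 (cell i) e) * weight e (cell j)))"
      by (simp only: weight_intertwines[OF c c])
    also have "\<dots> = (\<Sum>k\<in>V. of_bool (graph2 i k) * of_bool (k = j))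
        + (\<Sum>k\<in>V. weight (cell k) (cell j) * of_bool (cell_adj k i))
        + (\<Sum>k\<in>V. of_bool (joined2 (cell i) (cell k)) * weight (cell k) (cell j))"
      using d(2)[OF j, of "\<lambda>k. of_bool (graph2 i k)"] sum_cell_adj[OF i, of "\<lambda>e. weight e (cell j)"]
        sum_cell[of "\<lambda>e. of_bool (joined2 (cell i) e) * weight e (cell j)"] by (simp add: g2)
    also have "\<dots> = (\<Sum>k\<in>V. of_bool (graph2 i k) * Q k j)"
      by (simp add: Q_def g2 distrib_left distrib_right sum.distrib add.assoc cell_adj_sym[of _ i] mult.commute)
    finally show "(\<Sum>k\<in>V. Q i k * of_bool (graph1 k j)) = (\<Sum>k\<in>V. of_bool (graph2 i k) * Q k j)" .
  next
    fix i assume i: "i \<in> V"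
    show "(\<Sum>k\<in>V. Q i k) = 1"
      using i d sum_cell[of "weight (cell i)"] weight_sums(1)[OF c, of i] by (simp add: Q_def sum.distrib)
    show "(\<Sum>k\<in>V. Q k i) = 1"
      using i d sum_cell[of "\<lambda>e. weight e (cell i)"] weight_sums(2)[OF c, of i] by (simp add: Q_def sum.distrib)
  qed
qed

text \<open>The fixed pair on 16 vertices is carried over along an isomorphism. A join at the root
  is reduced to a union by complementing before and after.\<close>

lemma limb_replacement:
  assumes "rep b limb1 V E"
  obtains E' where "rep b limb2 V E'" "gen_similar V E E'"
proof -
  have *: "\<exists>E'. rep False limb2 V E' \<and> gen_similar V E E'" if r: "rep False limb1 V E" for E
  proof -
    obtain f where f: "bij_betw f {0..<16} V" "\<And>x y. x \<in> {0..<16} \<Longrightarrow> y \<in> {0..<16} \<Longrightarrow> graph1 x y = E (f x) (f y)"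
      using rep_parts_isom(1)[OF rep_limb1 r] unfolding isom_def by blast
    define g where "g = the_inv_into {0..<16} f"
    define E' where "E' x y = graph2 (g x) (g y)" for x y
    have inj: "inj_on f {0..<16}" and V: "V = f ` {0..<16}" using f(1) by (auto simp: bij_betw_def)
    have g: "g (f x) = x" if "x \<in> {0..<16}" for x using that inj by (simp only: g_def the_inv_into_f_f)
    have "rep False limb2 V E'" unfolding V
      by (rule rep_parts_transport(1)[OF rep_limb2 inj]) (simp only: E'_def g)
    moreover have "gen_similar V E E'" unfolding V
      by (rule gen_similar_transport[OF gen_similar_limbs inj]) (simp_all only: E'_def g f(2))
    ultimately show ?thesis by blast
  qed
  show thesis
  proof (cases b)
    case False
    then show thesis using *[of E] assms that by auto
  next
    case True
    have "rep False limb1 V (graph_compl V E)" using rep_parts_compl(1)[OF assms, of V] True by simp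
    then obtain E1 where E1: "rep False limb2 V E1" "gen_similar V (graph_compl V E) E1" using * by blast
    have "rep True limb2 V (graph_compl V E1)" using rep_parts_compl(1)[OF E1(1), of V] by simp
    moreover have "gen_similar V (graph_compl V (graph_compl V E)) (graph_compl V E1)"
      by (rule gen_similar_compl[OF E1(2)])
        (use rep_parts_card(1)[OF assms] rep_irrefl_sym(1)[OF E1(1)] in \<open>auto simp: graph_compl_def\<close>)
    then have "gen_similar V E (graph_compl V E1)"
      by (rule gen_similar_cong) (use rep_irrefl_sym(1)[OF assms] in \<open>auto simp: graph_compl_def\<close>)
    ultimately show thesis using that True by simp
  qed
qed

section \<open>Replacing limbs\<close>

text \<open>Exactly one occurrence of \<open>limb1\<close> is exchanged.\<close>

inductive swap :: "tree \<Rightarrow> tree \<Rightarrow> bool" where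
  here: "swap limb1 limb2"
| below: "swap s s' \<Longrightarrow> swap (Node (add_mset s M)) (Node (add_mset s' M))"

lemma limbs_neq: "limb1 \<noteq> limb2"
proof
  assume "limb1 = limb2"
  \<comment> \<open>The children have 3 and 13 leaves in \<open>limb1\<close>, but 5 and 11 in
    \<open>limb2\<close>.\<close>
  then have "image_mset leaves limb1_children =
      image_mset leaves {#Node {#Leaf, star 4#}, Node (add_mset (Node {#star 2, star 2, star 4#}) (replicate_mset 3 Leaf))#}"
    by (simp add: limb1_def limb2_def)
  then show False by (simp add: limb1_children_def star_def add_eq_conv_ex)
qed

lemma swap_neq: "swap t t' \<Longrightarrow> t \<noteq> t'"
  by (induction rule: swap.induct) (use limbs_neq in auto)

lemma swap_exists:
  assumes "adm {} t" "\<not> adm {limb1} t" shows "\<exists>t'. swap t t'"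
  using assms
proof (induction rule: adm.induct)
  case Leaf
  then show ?case by (auto intro: adm.Leaf)
next
  case (Node M)
  show ?case
  proof (cases "Node M = limb1")
    case True
    then show ?thesis using here by auto
  next
    case False
    then obtain s where s: "s \<in># M" "\<not> adm {limb1} s" using Node by (auto simp: adm_Node_iff)
    then obtain s' where "swap s s'" using Node.IH by blast
    moreover obtain M' where "M = add_mset s M'" using s by (metis mset_add)
    ultimately show ?thesis using below by blast
  qed
qed

text \<open>Along the path from the limb to the root, each block is a module of the next larger one,
  so the orthogonal matrix extends by the identity at every step.\<close>

lemma swap_rep:
  "swap t t' \<Longrightarrow> rep b t V E \<Longrightarrow> \<exists>E'. rep b t' V E' \<and> gen_similar V E E'"
proof (induction arbitrary: b V E rule: swap.induct)
  case here
  then show ?case using limb_replacement by metis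
next
  case (below s s' M)
  from below.prems have p: "parts b (add_mset s M) V E" "size (add_mset s M) \<ge> 2"
    by (auto elim: rep.cases)
  obtain W R where W: "V = R \<union> W" "rep (\<not> b) s W E" "cross b R W E" "parts b M R E"
    using parts_add_mset[OF p(1)] by (elim exE conjE)
  obtain E1 where E1: "rep (\<not> b) s' W E1" "gen_similar W E E1" using below.IH[OF W(2)] by (elim exE conjE)
  define E' where "E' x y = (if x \<in> W \<and> y \<in> W then E1 x y else E x y)" for x y
  have disj: "x \<notin> W" if "x \<in> R" for x using that W(3) by (auto simp: cross_def)
  have cr: "cross b R W E'" using W(3) disj by (auto simp: cross_def E'_def)
  have "parts b (add_mset s' M) (R \<union> W) E'"
  proof (rule parts_add)
    show "parts b M R E'" by (rule parts_cong[OF W(4)]) (use disj in \<open>auto simp: E'_def\<close>)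
    show "rep (\<not> b) s' W E'" by (rule rep_cong[OF E1(1)]) (auto simp: E'_def)
  qed (rule cr)
  then have "rep b (Node (add_mset s' M)) V E'"
    unfolding W(1) by (rule rep_Node) (use p(2) in simp)
  moreover have "gen_similar W E E'"
    by (rule gen_similar_cong[OF E1(2)]) (auto simp: E'_def)
  then have "gen_similar V E E'" unfolding W(1)
    by (rule gen_similar_module)
      (use W(3) cr disj rep_parts_card(1)[OF W(2)] rep_parts_card(2)[OF W(4)] in \<open>auto simp: E'_def\<close>)
  ultimately show ?case by blast
qed

text \<open>An isomorphism would give \<open>G\<close> two different cotrees with the same root
  type, contrary to \<open>rep_parts_unique\<close>.\<close>

lemma has_mate:
  assumes "rep b t {0..<n} G" "\<not> adm {limb1} t"
  shows "has_gc_cograph_mate n G"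
proof -
  let ?V = "{0..<n}"
  have "adm {} t" using rep_parts_card(1)[OF assms(1)] by simp
  then obtain t' where t': "swap t t'" using swap_exists assms(2) by blast
  obtain E' where E': "rep b t' ?V E'" "gen_similar ?V G E'" using swap_rep[OF t' assms(1)] by (elim exE conjE)
  define H where "H = restrict_graph ?V E'"
  have HE: "H x y = E' x y" if "x \<in> ?V" "y \<in> ?V" for x y using that by (simp add: H_def restrict_graph_def)
  have rH: "rep b t' ?V H" by (rule rep_cong[OF E'(1) HE])
  have sim: "gen_similar ?V G H" by (rule gen_similar_cong[OF E'(2) refl HE])
  have "H \<in> cographs_on n"
    using rep_parts_cograph(1)[OF E'(1)] by (simp add: cographs_on_def H_def)
  moreover have "\<not> graph_iso n H G"
  proof
    assume "graph_iso n H G"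
    then obtain f where f: "bij_betw f ?V ?V" "\<And>x y. x \<in> ?V \<Longrightarrow> y \<in> ?V \<Longrightarrow> G (f x) (f y) = H x y"
      unfolding graph_iso_def by blast
    have "rep b t' (f ` ?V) G"
      by (rule rep_parts_transport(1)[OF rH]) (use f in \<open>auto simp: bij_betw_def\<close>)
    then have "rep b t' ?V G" using f(1) by (simp add: bij_betw_def)
    then show False using rep_parts_unique(1)[OF assms(1)] swap_neq[OF t'] by blast
  qed
  moreover have "Spec n H = Spec n G" by (rule gen_similar_Spec[OF sim])
  moreover have "gen_similar ?V (graph_compl ?V G) (graph_compl ?V H)"
    by (rule gen_similar_compl[OF sim])
      (use rep_irrefl_sym(1)[OF assms(1)] rep_irrefl_sym(1)[OF rH] in auto)
  then have "Spec n (graph_compl ?V H) = Spec n (graph_compl ?V G)" by (rule gen_similar_Spec)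
  ultimately show ?thesis unfolding has_gc_cograph_mate_def by blast
qed

section \<open>Counting isomorphism classes by cotrees\<close>

definition cotree_class :: "nat \<Rightarrow> bool \<times> tree \<Rightarrow> (nat \<Rightarrow> nat \<Rightarrow> bool) set" where
  "cotree_class n p = {E. rep (fst p) (snd p) {0..<n} E}"

lemma iso_class_eq:
  assumes "rep b t {0..<n} G" shows "iso_rel n `` {G} = cotree_class n (b, t)"
proof (intro equalityI subsetI)
  fix E assume "E \<in> iso_rel n `` {G}"
  then obtain f where f: "bij_betw f {0..<n} {0..<n}" "\<And>x y. x \<in> {0..<n} \<Longrightarrow> y \<in> {0..<n} \<Longrightarrow> E (f x) (f y) = G x y"
    unfolding iso_rel_def graph_iso_def by blast
  have "rep b t (f ` {0..<n}) E"
    by (rule rep_parts_transport(1)[OF assms]) (use f in \<open>auto simp: bij_betw_def\<close>)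
  then show "E \<in> cotree_class n (b, t)" using f(1) by (simp add: bij_betw_def cotree_class_def)
next
  fix E assume "E \<in> cotree_class n (b, t)"
  then have "isom {0..<n} G {0..<n} E"
    using rep_parts_isom(1)[OF assms] by (simp add: cotree_class_def)
  then show "E \<in> iso_rel n `` {G}" by (simp add: iso_rel_def graph_iso_def isom_def)
qed

text \<open>The map is not injective for n = 1, where both root types give the same class; hence
  only inequalities between counts are drawn from this image.\<close>

lemma cograph_classes_eq:
  "cograph_classes n = cotree_class n ` (UNIV \<times> {t. adm {} t \<and> leaves t = n})"
proof (intro equalityI subsetI)
  fix C assume "C \<in> cograph_classes n"
  then obtain G where G: "cograph {0..<n} G" "C = iso_rel n `` {G}"
    by (auto simp: cograph_classes_def cographs_on_def elim: quotientE)
  obtain b t where r: "rep b t {0..<n} G" using cograph_rep[OF G(1)] by (elim exE)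
  have "adm {} t" "leaves t = n" using rep_parts_card(1)[OF r] by auto
  then show "C \<in> cotree_class n ` (UNIV \<times> {t. adm {} t \<and> leaves t = n})"
    unfolding G(2) iso_class_eq[OF r] by (intro imageI) simp
next
  fix C assume "C \<in> cotree_class n ` (UNIV \<times> {t. adm {} t \<and> leaves t = n})"
  then obtain b t where t: "adm {} t" "leaves t = n" "C = cotree_class n (b, t)" by auto
  obtain E where E: "rep b t {0..<n} E" using rep_exists[of t "{0..<n}" b] t by auto
  have "rep b t {0..<n} (restrict_graph {0..<n} E)"
    by (rule rep_cong[OF E]) (simp add: restrict_graph_def)
  then have "C = iso_rel n `` {restrict_graph {0..<n} E}" using iso_class_eq t(3) by simp
  moreover have "restrict_graph {0..<n} E \<in> cographs_on n"
    using rep_parts_cograph(1)[OF E] by (simp add: cographs_on_def)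
  ultimately show "C \<in> cograph_classes n" unfolding cograph_classes_def by (auto intro: quotientI)
qed

lemma finite_cograph_classes: "finite (cograph_classes n)"
  unfolding cograph_classes_eq using finite_trees_eq[of "{}" n] by (intro finite_imageI finite_cartesian_product) auto

text \<open>With one root type fixed, uniqueness of cotrees makes the map to classes
  injective.\<close>

lemma tree_count_le_c_count: "tree_count {} n \<le> c_count n"
proof -
  let ?T = "{t. adm {} t \<and> leaves t = n}"
  have "inj_on (\<lambda>t. cotree_class n (False, t)) ?T"
  proof (rule inj_onI)
    fix t t' assume t: "t \<in> ?T" and eq: "cotree_class n (False, t) = cotree_class n (False, t')"
    obtain E where E: "rep False t {0..<n} E" using rep_exists[of t "{0..<n}" False] t by auto
    then have "rep False t' {0..<n} E" using eq by (auto simp: cotree_class_def)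
    then show "t = t'" using rep_parts_unique(1)[OF E] by blast
  qed
  then have "card ?T \<le> card (cograph_classes n)"
    by (rule card_inj_on_le[OF _ _ finite_cograph_classes]) (auto simp: cograph_classes_eq)
  then show ?thesis by (simp add: tree_count_def c_count_def)
qed

text \<open>A class without a mate has a cotree avoiding \<open>limb1\<close>; the two possible root
  types account for the factor 2.\<close>

lemma c_count_le_h_count: "c_count n \<le> h_count n + 2 * tree_count {limb1} n"
proof -
  let ?M = "{C \<in> cograph_classes n. \<exists>G\<in>C. has_gc_cograph_mate n G}"
  let ?B = "{t. adm {limb1} t \<and> leaves t = n}"
  have fin: "finite (UNIV \<times> ?B :: (bool \<times> tree) set)" using finite_trees_eq[of "{limb1}" n] by (intro finite_cartesian_product) auto
  have "cograph_classes n \<subseteq> ?M \<union> cotree_class n ` (UNIV \<times> ?B)"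
  proof
    fix C assume C: "C \<in> cograph_classes n"
    then obtain b t where t: "adm {} t" "leaves t = n" "C = cotree_class n (b, t)"
      unfolding cograph_classes_eq by auto
    obtain E where E: "rep b t {0..<n} E" using rep_exists[of t "{0..<n}" b] t by auto
    show "C \<in> ?M \<union> cotree_class n ` (UNIV \<times> ?B)"
    proof (cases "adm {limb1} t")
      case True
      then show ?thesis using t by auto
    next
      case False
      then have "has_gc_cograph_mate n E" by (rule has_mate[OF E])
      moreover have "E \<in> C" using E t by (simp add: cotree_class_def)
      ultimately show ?thesis using C by blast
    qed
  qed
  then have "card (cograph_classes n) \<le> card (?M \<union> cotree_class n ` (UNIV \<times> ?B))"
    using fin finite_cograph_classes[of n] by (intro card_mono) auto
  also have "\<dots> \<le> card ?M + card (cotree_class n ` (UNIV \<times> ?B))" by (rule card_Un_le)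
  also have "card (cotree_class n ` (UNIV \<times> ?B)) \<le> card (UNIV \<times> ?B :: (bool \<times> tree) set)"
    by (rule card_image_le[OF fin])
  finally show ?thesis by (simp add: c_count_def h_count_def tree_count_def card_cartesian_product)
qed

lemma adm_limb1: "adm {} limb1"
  by (auto simp: limb1_def limb1_children_def star_def adm_Node_iff intro: adm.Leaf)

theorem theorem4p2:
  shows "(\<lambda>n. real (h_count n) / real (c_count n)) \<longlonglongrightarrow> 1"
proof -
  let ?r = "\<lambda>n. real (tree_count {limb1} n) / real (tree_count {} n)"
  \<comment> \<open>\<open>limb1_def\<close> serves as the equation
    \<open>F = Node M0\<close>.\<close>
  have "?r \<longlonglongrightarrow> 0" by (rule avoiding_fraction_tendsto_0[OF adm_limb1 limb1_def])
  then have lim: "(\<lambda>n. 1 - 2 * ?r n) \<longlonglongrightarrow> 1 - 2 * 0" by (intro tendsto_intros)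
  show ?thesis
  proof (rule real_tendsto_sandwich)
    show "\<forall>\<^sub>F n in sequentially. 1 - 2 * ?r n \<le> real (h_count n) / real (c_count n)"
    proof (rule eventually_sequentiallyI[of 1])
      fix n :: nat assume "1 \<le> n"
      then have a: "0 < real (tree_count {} n)" using tree_count_pos[of n] by simp
      have ac: "real (tree_count {} n) \<le> real (c_count n)" using tree_count_le_c_count[of n] by simp
      have "real (c_count n) \<le> real (h_count n) + 2 * real (tree_count {limb1} n)"
        using c_count_le_h_count[of n] by linarith
      then have "1 \<le> (real (h_count n) + 2 * real (tree_count {limb1} n)) / real (c_count n)"
        using a ac by simp
      moreover have "real (tree_count {limb1} n) / real (c_count n) \<le> ?r n"
        using a ac by (intro divide_left_mono) auto
      ultimately show "1 - 2 * ?r n \<le> real (h_count n) / real (c_count n)"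
        by (simp add: add_divide_distrib)
    qed
    show "\<forall>\<^sub>F n in sequentially. real (h_count n) / real (c_count n) \<le> 1"
    proof (rule always_eventually, rule allI)
      fix n
      have "h_count n \<le> c_count n" unfolding h_count_def c_count_def
        by (rule card_mono[OF finite_cograph_classes]) auto
      \<comment> \<open>For n = 0 there are no cographs, and division by zero gives 0.\<close>
      then show "real (h_count n) / real (c_count n) \<le> 1" by (cases "c_count n = 0") (simp_all add: divide_le_eq_1)
    qed
    show "(\<lambda>n. 1 - 2 * ?r n) \<longlonglongrightarrow> 1" using lim by simp
  qed auto
qed

end
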